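(* Let $|q|<1$ and $(a,b)$ a pair of coprime integers with $1\leq b<a$. If $a<2b$ then \[ \sum_{m\in\mathbb Z_{\ge0}^d}\frac{q^{m^TCm}}{(q)_{2m_1}}\prod_{j=2}^d\begin{bmatrix}\tau_jm_j+n_j\\ \tau_jm_j\end{bmatrix}_{q^{\bar\tau_j}}=\frac{(q^{ab},q^{ab},q^{2ab};q^{2ab})_\infty}{(q;q)_\infty}, \] and if $a\ge 2b$ then \[ \sum_{\substack{n_1,\dots,n_{a_0}\ge0\\ m_{a_0+1},\dots,m_d\ge0}}\frac{q^{\sum_{i=1}^{a_0}(N_i+m_{a_0+1})^2+\sum_{j,k=a_0+1}^dm_jC_{j,k}m_k}}{(q)_{n_1}\cdots(q)_{n_{a_0-1}}(q^{\bar\tau_{a_0}};q^{\bar\tau_{a_0}})_{n_{a_0}}(q^{\bar\tau_{a_0+1}};q^{\bar\tau_{a_0+1}})_{\tau_{a_0+1}m_{a_0+1}}}\prod_{j=a_0+2}^d\begin{bmatrix}\tau_jm_j+n_j\\ \tau_jm_j\end{bmatrix}_{q^{\bar\tau_j}}=\frac{(q^{ab},q^{ab},q^{2ab};q^{2ab})_\infty}{(q;q)_\infty}. \]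
   Context: Notation: $(x;q)_n=\prod_{i=0}^{n-1}(1-xq^i)$ (also $n=\infty$), $(q)_n=(q;q)_n$, $(x_1,\dots,x_r;q)_\infty=\prod_i(x_i;q)_\infty$; $\begin{bmatrix}N\\ m\end{bmatrix}_q=\frac{(q)_N}{(q)_m(q)_{N-m}}$ if $m,N-m$ are nonnegative integers, $0$ otherwise, and $\begin{bmatrix}N\\ m\end{bmatrix}_{q^k}$ is the same with $q$ replaced by $q^k$. Continued-fraction data: for coprime $1\le b<a$ let $\mathrm{cf}(a,b)=(a/b-1)^{s}$ with $s=1$ if $a>2b$, $s=-1$ if $a<2b$, $s=0$ if $a=2b$. Write $\mathrm{cf}(a,b)=[a_0,\dots,a_n]$ (regular continued fraction with positive integer partial quotients), choosing $a_n\ge 2$ when $(a,b)\ne(2,1)$ (and $\mathrm{cf}(2,1)=[1]$). Put $t_0=0$, $t_j=a_0+\dots+a_{j-1}$ ($1\le j\le n+1$), $d=t_{n+1}$. $\mathcal I$ is the $d\times d$ matrix with $\mathcal I_{j,k}=\delta_{j,k+1}+\delta_{j,k-1}$ if $j\notin\{t_1,\dots,t_{n+1}\}$ and $\delta_{j,k+1}+\delta_{j,k}-\delta_{j,k-1}$ otherwise; $C=2I-\mathcal I$. $\tau_j=2$ for $j<d$, $\tau_d=1$, and $\bar\tau_j=3-\tau_j$. $m^TCm=\sum_{j,k}m_jC_{j,k}m_k$. In the case $a<2b$: $n_j=-\sum_{k=1}^dC_{j,k}m_k$ for $j\ge2$. In the case $a\ge 2b$: $N_i=n_i+\dots+n_{a_0}$;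 $n_j=-\sum_{k=a_0+1}^dC_{j,k}m_k$ for $j\ge a_0+2$; if $d=a_0$ (exactly when $b=1$) there are no variables $m_{a_0+1},\dots,m_d$, one sets $m_{a_0+1}=0$ (so the corresponding factor $(q^{\bar\tau_{a_0+1}};q^{\bar\tau_{a_0+1}})_0=1$), and the sum over $j,k\ge a_0+1$ and the final product are empty. *)

theory Defs
  imports "HOL-Analysis.Analysis"
begin

definition qpoch :: "complex \<Rightarrow> complex \<Rightarrow> nat \<Rightarrow> complex" where
  "qpoch x q n = (\<Prod>i<n. (1 - x * q ^ i))"

definition qpoch_inf :: "complex \<Rightarrow> complex \<Rightarrow> complex" where
  "qpoch_inf x q = prodinf (\<lambda>i. 1 - x * q ^ i)"

definition qbinom :: "complex \<Rightarrow> int \<Rightarrow> int \<Rightarrow> complex" where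
  "qbinom q N m = (if 0 \<le> m \<and> 0 \<le> N - m
     then qpoch q q (nat N) / (qpoch q q (nat m) * qpoch q q (nat (N - m))) else 0)"

fun cfval :: "nat list \<Rightarrow> rat" where
  "cfval [] = 0"
| "cfval [c] = of_nat c"
| "cfval (c # cs) = of_nat c + 1 / cfval cs"

definition cf_sign :: "nat \<Rightarrow> nat \<Rightarrow> int" where
  "cf_sign a b = (if a > 2 * b then 1 else if a < 2 * b then -1 else 0)"

definition cf_target :: "nat \<Rightarrow> nat \<Rightarrow> rat" where
  "cf_target a b = (of_nat a / of_nat b - 1) powi cf_sign a b"

definition is_cf_expansion :: "nat \<Rightarrow> nat \<Rightarrow> nat list \<Rightarrow> bool" where
  "is_cf_expansion a b cs \<longleftrightarrow>
     cs \<noteq> [] \<and> (\<forall>c\<in>set cs. 1 \<le> c) \<and> cfval cs = cf_target a b \<and>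
     (if (a, b) = (2, 1) then cs = [1] else 2 \<le> last cs)"

definition tpos :: "nat list \<Rightarrow> nat \<Rightarrow> nat" where
  "tpos cs j = sum_list (take j cs)"

definition dimC :: "nat list \<Rightarrow> nat" where
  "dimC cs = sum_list cs"

definition Tset :: "nat list \<Rightarrow> nat set" where
  "Tset cs = {tpos cs j | j. 1 \<le> j \<and> j \<le> length cs}"

definition dlt :: "int \<Rightarrow> int \<Rightarrow> int" where
  "dlt x y = (if x = y then 1 else 0)"

text \<open>the matrix \<I> (indices 1..d)\<close>
definition Iscr :: "nat list \<Rightarrow> nat \<Rightarrow> nat \<Rightarrow> int" where
  "Iscr cs j k = (if j \<notin> Tset cs
     then dlt (int j) (int k + 1) + dlt (int j) (int k - 1)
     else dlt (int j) (int k + 1) + dlt (int j) (int k) - dlt (int j) (int k - 1))"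

definition Cmat :: "nat list \<Rightarrow> nat \<Rightarrow> nat \<Rightarrow> int" where
  "Cmat cs j k = 2 * dlt (int j) (int k) - Iscr cs j k"

definition tau :: "nat list \<Rightarrow> nat \<Rightarrow> nat" where
  "tau cs j = (if j < dimC cs then 2 else 1)"

definition taubar :: "nat list \<Rightarrow> nat \<Rightarrow> nat" where
  "taubar cs j = 3 - tau cs j"

text \<open>Case a < 2b. m : {1..d} -> N (zero outside {1..d}).\<close>
definition nA :: "nat list \<Rightarrow> (nat \<Rightarrow> nat) \<Rightarrow> nat \<Rightarrow> int" where
  "nA cs m j = - (\<Sum>k\<in>{1..dimC cs}. Cmat cs j k * int (m k))"

definition summandA :: "complex \<Rightarrow> nat list \<Rightarrow> (nat \<Rightarrow> nat) \<Rightarrow> complex" where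
  "summandA q cs m =
     q powi (\<Sum>j\<in>{1..dimC cs}. \<Sum>k\<in>{1..dimC cs}. int (m j) * Cmat cs j k * int (m k))
     / qpoch q q (2 * m 1)
     * (\<Prod>j\<in>{2..dimC cs}.
          qbinom (q ^ taubar cs j) (int (tau cs j * m j) + nA cs m j) (int (tau cs j * m j)))"

text \<open>Case a \<ge> 2b. n : {1..a_0} -> N, m : {a_0+1..d} -> N (zero elsewhere).\<close>
definition nB :: "nat list \<Rightarrow> (nat \<Rightarrow> nat) \<Rightarrow> nat \<Rightarrow> int" where
  "nB cs m j = - (\<Sum>k\<in>{cs ! 0 + 1..dimC cs}. Cmat cs j k * int (m k))"

definition NB :: "nat list \<Rightarrow> (nat \<Rightarrow> nat) \<Rightarrow> nat \<Rightarrow> int" where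
  "NB cs n i = (\<Sum>l\<in>{i..cs ! 0}. int (n l))"

definition summandB :: "complex \<Rightarrow> nat list \<Rightarrow> (nat \<Rightarrow> nat) \<Rightarrow> (nat \<Rightarrow> nat) \<Rightarrow> complex" where
  "summandB q cs n m =
     (let a0 = cs ! 0; d = dimC cs in
     q powi ((\<Sum>i\<in>{1..a0}. (NB cs n i + int (m (a0 + 1))) ^ 2)
             + (\<Sum>j\<in>{a0+1..d}. \<Sum>k\<in>{a0+1..d}. int (m j) * Cmat cs j k * int (m k)))
     / ((\<Prod>i\<in>{1..<a0}. qpoch q q (n i))
        * qpoch (q ^ taubar cs a0) (q ^ taubar cs a0) (n a0)
        * qpoch (q ^ taubar cs (a0 + 1)) (q ^ taubar cs (a0 + 1)) (tau cs (a0 + 1) * m (a0 + 1)))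
     * (\<Prod>j\<in>{a0+2..d}.
          qbinom (q ^ taubar cs j) (int (tau cs j * m j) + nB cs m j) (int (tau cs j * m j))))"

definition rhs :: "complex \<Rightarrow> nat \<Rightarrow> nat \<Rightarrow> complex" where
  "rhs q a b = qpoch_inf (q ^ (a*b)) (q ^ (2*a*b)) * qpoch_inf (q ^ (a*b)) (q ^ (2*a*b))
      * qpoch_inf (q ^ (2*a*b)) (q ^ (2*a*b)) / qpoch_inf q q"

end

theory Submission
  imports Defs
begin

text \<open>
  The \<open>q\<close>-Saalschuetz sum says that the products
  \<open>B(L,M,a,b) = [L+M+a-b; L+a] [L+M-a+b; L-a]\<close> of \<open>q\<close>-binomials satisfy the Burge transform
  \<open>\<Sum>\<^sub>i q^(i\<^sup>2) [2L+M-i; 2L] B(L-i,i,a,b) = q^(b\<^sup>2) B(L,M,a+b,b)\<close>, and they have the symmetry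
  \<open>B(L,M,a,b) = B(M,L,b,a)\<close>. Hence \<open>F\<^bsub>\<alpha>,\<beta>\<^esub>(L,M) = \<Sum>\<^sub>j (-1)^j q^(\<alpha>\<beta>j\<^sup>2) B(L,M,\<alpha>j,\<beta>j)\<close> can be
  reduced by the Euclidean algorithm on \<open>(\<alpha>,\<beta>)\<close> to \<open>F\<^bsub>1,1\<^esub>(L,M) = [L+M; L]\<close> in base \<open>q\<^sup>2\<close>, each
  subtraction costing one summation. For \<open>\<alpha> = a - b\<close>, \<open>\<beta> = b\<close> the sum \<open>\<Sum>\<^sub>i q^(i\<^sup>2) F\<^bsub>\<alpha>,\<beta>\<^esub>(\<infinity>,i)\<close> equals
  \<open>(q)\<^sub>\<infinity>\<^sup>-\<^sup>1 \<Sum>\<^sub>j (-1)^j q^(abj\<^sup>2)\<close>, which is the product side, while unfolding \<open>F\<close> along the continued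
  fraction of \<open>\<alpha>/\<beta>\<close> gives the multiple sum. All summands at \<open>q\<close> are dominated by those at \<open>|q|\<close>, so
  absolute convergence follows from the same identities over the reals.
\<close>

section \<open>Gaussian binomials\<close>

text \<open>The sums F alternate in sign, so their size at complex \<open>q\<close> cannot be read
  off from their definition. Unfolded along the continued fraction they involve only powers of
  \<open>q\<close>, Gaussian binomials and factors 1/(q)_n, all with nonnegative coefficients,
  whence |F(q)| <= F(|q|). This is why the identities are proved over a general
  \<open>real_normed_field\<close>: they are used both at \<open>q\<close> and at
  \<open>norm q\<close>. Each new variable splits an existing term into a finite sum, so a
  nonnegative majorant summable over the coarse index set remains summable over the finer one, and
  no multiple series has to be estimated directly. The first partial quotient is used up while L is
  infinite; each subtraction then costs a factor 1/(q)_n, which is the origin of the variables n.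
  Exchanging the arguments makes the second one infinite, and the next subtraction makes both finite
  at the cost of 1/(q)_(2m). From there on every subtraction costs a Gaussian binomial.\<close>

definition qfac :: "'a::real_normed_field \<Rightarrow> nat \<Rightarrow> 'a" where
  "qfac q n = (\<Prod>i<n. 1 - q ^ Suc i)"

text \<open>The recursion makes sense for every \<open>q\<close> and shows a polynomial with
  nonnegative coefficients; the bound \<open>norm_gauss_binom_le\<close> rests on this. A quotient
  of \<open>qfac\<close> would hide it.\<close>

fun gauss_binom :: "'a::comm_ring_1 \<Rightarrow> nat \<Rightarrow> nat \<Rightarrow> 'a" where
  "gauss_binom q n 0 = 1"
| "gauss_binom q 0 (Suc k) = 0"
| "gauss_binom q (Suc n) (Suc k) = gauss_binom q n k + q ^ Suc k * gauss_binom q n (Suc k)"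

lemma qfac_0 [simp]: "qfac q 0 = 1"
  by (simp add: qfac_def)

lemma qfac_Suc: "qfac q (Suc n) = qfac q n * (1 - q ^ Suc n)"
  by (simp add: qfac_def)

lemma gauss_binom_eq_0 [simp]: "n < k \<Longrightarrow> gauss_binom q n k = 0"
  by (induction q n k rule: gauss_binom.induct) auto

lemma gauss_binom_self [simp]: "gauss_binom q n n = 1"
  by (induction n) auto

lemma gauss_binom_mult_qfac:
  fixes q :: "'a::real_normed_field"
  shows "k \<le> n \<Longrightarrow> gauss_binom q n k * (qfac q k * qfac q (n - k)) = qfac q n"
proof (induction q n k rule: gauss_binom.induct)
  case (3 q n k)
  show ?case
  proof (cases "k = n")
    case True
    then show ?thesis by simp
  next
    case False
    then have kn: "k < n" using 3 by simp
    have s: "n - k = Suc (n - Suc k)" using kn by simp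
    have a: "gauss_binom q n k * (qfac q k * qfac q (n - k)) = qfac q n"
      and b: "gauss_binom q n (Suc k) * (qfac q (Suc k) * qfac q (n - Suc k)) = qfac q n"
      using 3 kn by auto
    have "gauss_binom q (Suc n) (Suc k) * (qfac q (Suc k) * qfac q (Suc n - Suc k))
      = (gauss_binom q n k * (qfac q k * qfac q (n - k))) * (1 - q ^ Suc k)
        + q ^ Suc k * (gauss_binom q n (Suc k) * (qfac q (Suc k) * qfac q (n - Suc k))) * (1 - q ^ (n - k))"
      by (simp add: qfac_Suc[of q k] qfac_Suc[of q "n - Suc k", folded s] algebra_simps)
    \<comment> \<open>The brackets combine by (1 - q^(k+1)) + q^(k+1) (1 - q^(n-k)) = 1 -
      q^(n+1).\<close>
    also have "\<dots> = qfac q n * (1 - q ^ (Suc k + (n - k)))"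
      unfolding a b power_add by (simp add: algebra_simps)
    also have "Suc k + (n - k) = Suc n" using kn by simp
    finally show ?thesis by (simp only: qfac_Suc)
  qed
qed auto

lemma qfac_nonzero:
  fixes q :: "'a::real_normed_field"
  assumes "norm q < 1"
  shows "qfac q n \<noteq> 0"
proof -
  have "q ^ Suc i \<noteq> 1" for i
  proof
    assume "q ^ Suc i = 1"
    then have "norm q ^ Suc i = 1" by (metis norm_one norm_power)
    then show False using power_less_one_iff[of "norm q" "Suc i"] assms by simp
  qed
  then show ?thesis by (auto simp: qfac_def)
qed

lemma gauss_binom_eq:
  fixes q :: "'a::real_normed_field"
  assumes "norm q < 1" "k \<le> n"
  shows "gauss_binom q n k = qfac q n / (qfac q k * qfac q (n - k))"
  using gauss_binom_mult_qfac[OF assms(2), of q] qfac_nonzero[OF assms(1)] by (simp add: field_simps)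

lemma gauss_binom_sym:
  fixes q :: "'a::real_normed_field"
  assumes "norm q < 1" "k \<le> n"
  shows "gauss_binom q n (n - k) = gauss_binom q n k"
  using assms by (simp add: gauss_binom_eq mult.commute)

lemma gauss_binom_sym_add:
  fixes q :: "'a::real_normed_field"
  assumes "norm q < 1"
  shows "gauss_binom q (m + n) n = gauss_binom q (m + n) m"
  using gauss_binom_sym[OF assms, of m "m + n"] by simp

lemma gauss_binom_Suc':
  fixes q :: "'a::real_normed_field"
  assumes "norm q < 1"
  shows "gauss_binom q (Suc n) (Suc k) = gauss_binom q n (Suc k) + q ^ (n - k) * gauss_binom q n k"
proof (cases "k < n")
  case True
  then have s: "n - k = Suc (n - Suc k)" by simp
  have "gauss_binom q (Suc n) (Suc k) = gauss_binom q (Suc n) (n - k)"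
    using gauss_binom_sym[OF assms, of "Suc k" "Suc n"] True by simp
  also have "\<dots> = gauss_binom q n (n - Suc k) + q ^ (n - k) * gauss_binom q n (n - k)"
    unfolding s by simp
  finally show ?thesis using gauss_binom_sym[OF assms, of "Suc k" n] gauss_binom_sym[OF assms, of k n] True by simp
next
  case False
  then show ?thesis by (cases "k = n") auto
qed

text \<open>Induction on \<open>n\<close> by the second Pascal rule. Truncation in the exponent is
  harmless: if \<open>m + y < r\<close>, then the factor with lower entry \<open>r - y\<close> is
  zero.\<close>

lemma gauss_binom_vandermonde:
  fixes q :: "'a::real_normed_field"
  assumes q: "norm q < 1"
  shows "gauss_binom q (m + n) r = (\<Sum>y\<le>r. q ^ (y * (m + y - r)) * gauss_binom q n y * gauss_binom q m (r - y))"
proof (induction n arbitrary: r)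
  case 0
  have "(\<Sum>y\<le>r. q ^ (y * (m + y - r)) * gauss_binom q 0 y * gauss_binom q m (r - y)) =
        (\<Sum>y\<in>{0}. q ^ (y * (m + y - r)) * gauss_binom q 0 y * gauss_binom q m (r - y))"
    by (rule sum.mono_neutral_right) auto
  then show ?case by simp
next
  case (Suc n)
  show ?case
  proof (cases r)
    case 0
    then show ?thesis by simp
  next
    case (Suc r')
    let ?t = "\<lambda>r y. q ^ (y * (m + y - r)) * gauss_binom q n y * gauss_binom q m (r - y)"
    let ?u = "\<lambda>y. q ^ (Suc y * (m + y - r')) * (q ^ (n - y) * gauss_binom q n y) * gauss_binom q m (r' - y)"
    \<comment> \<open>The exponents agree as long as no difference is truncated; in the remaining
      cases a binomial vanishes on both sides.\<close>
    have u: "?u y = q ^ (m + n - r') * ?t r' y" for y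
    proof (cases "y \<le> n \<and> r' - y \<le> m")
      case True
      then have "Suc y * (m + y - r') + (n - y) = (m + n - r') + y * (m + y - r')"
        by auto
      then have "q ^ (Suc y * (m + y - r')) * q ^ (n - y) = q ^ (m + n - r') * q ^ (y * (m + y - r'))"
        by (metis power_add)
      then show ?thesis by (simp add: mult.assoc[symmetric])
    qed auto
    have "(\<Sum>y\<le>r. q ^ (y * (m + y - r)) * gauss_binom q (Suc n) y * gauss_binom q m (r - y))
       = ?t r 0 + (\<Sum>y\<le>r'. ?t r (Suc y) + ?u y)"
      unfolding Suc sum.atMost_Suc_shift gauss_binom_Suc'[OF q] by (simp add: algebra_simps del: gauss_binom.simps(3))
    also have "\<dots> = (\<Sum>y\<le>r. ?t r y) + q ^ (m + n - r') * (\<Sum>y\<le>r'. ?t r' y)"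
      unfolding Suc sum.atMost_Suc_shift u by (simp add: sum.distrib sum_distrib_left)
    also have "\<dots> = gauss_binom q (m + n) r + q ^ (m + n - r') * gauss_binom q (m + n) r'"
      using Suc.IH by simp
    also have "\<dots> = gauss_binom q (m + Suc n) r"
      unfolding Suc using gauss_binom_Suc'[OF q, of "m + n" r'] by simp
    finally show ?thesis by simp
  qed
qed

text \<open>Vandermonde with \<open>y = k + c\<close> and one binomial reflected. The bound
  \<open>K\<close> may be any number beyond the support, which is cut off both by
  \<open>k \<le> A\<close> and by \<open>k + c \<le> D\<close>.\<close>

lemma gauss_binom_vandermonde_shift:
  fixes q :: "'a::real_normed_field"
  assumes q: "norm q < 1" and K: "A \<le> K \<or> D \<le> K + c"
  shows "(\<Sum>k\<le>K. q ^ (k * (k + c)) * gauss_binom q A k * gauss_binom q D (k + c)) = gauss_binom q (A + D) (A + c)"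
proof -
  let ?g = "\<lambda>k. q ^ (k * (k + c)) * gauss_binom q A k * gauss_binom q D (k + c)"
  have "gauss_binom q (A + D) (A + c) =
        (\<Sum>y\<le>A + c. q ^ (y * (A + y - (A + c))) * gauss_binom q D y * gauss_binom q A (A + c - y))"
    by (rule gauss_binom_vandermonde[OF q])
  also have "\<dots> = (\<Sum>y\<in>{c..A + c}. q ^ (y * (A + y - (A + c))) * gauss_binom q D y * gauss_binom q A (A + c - y))"
    by (rule sum.mono_neutral_right) auto
  also have "\<dots> = (\<Sum>k\<le>A. ?g k)"
  proof (rule sum.reindex_bij_witness[of _ "\<lambda>k. k + c" "\<lambda>y. y - c"])
    fix y assume "y \<in> {c..A + c}"
    moreover from this have "gauss_binom q A (A + c - y) = gauss_binom q A (y - c)"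
      using gauss_binom_sym[OF q, of "y - c" A] by (auto simp: Nat.diff_diff_right)
    ultimately show "?g (y - c) = q ^ (y * (A + y - (A + c))) * gauss_binom q D y * gauss_binom q A (A + c - y)"
      by (simp add: mult.commute)
  qed auto
  also have "\<dots> = (\<Sum>k\<in>{..A} \<inter> {..K}. ?g k)"
    using K by (intro sum.mono_neutral_right) auto
  also have "\<dots> = (\<Sum>k\<le>K. ?g k)"
    by (rule sum.mono_neutral_left) auto
  finally show ?thesis ..
qed

text \<open>Both sides are the \<open>q\<close>-trinomial (q)_(x+y+z) / ((q)_x (q)_y (q)_z).\<close>

lemma gauss_binom_trinomial_revision:
  fixes q :: "'a::real_normed_field"
  assumes q: "norm q < 1"
  shows "gauss_binom q (x + y + z) x * gauss_binom q (y + z) y = gauss_binom q (x + y + z) y * gauss_binom q (x + z) x"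
proof -
  have "gauss_binom q (x + y + z) x = qfac q (x + y + z) / (qfac q x * qfac q (y + z))"
    "gauss_binom q (y + z) y = qfac q (y + z) / (qfac q y * qfac q z)"
    "gauss_binom q (x + y + z) y = qfac q (x + y + z) / (qfac q y * qfac q (x + z))"
    "gauss_binom q (x + z) x = qfac q (x + z) / (qfac q x * qfac q z)"
    using q by (simp_all add: gauss_binom_eq ac_simps)
  then show ?thesis using qfac_nonzero[OF q] by simp
qed

text \<open>Riordan's argument: expand the first binomial by Vandermonde so that its power of \<open>q\<close> does
  not involve \<open>k\<close>, sum over \<open>k\<close> by Vandermonde, then over \<open>y\<close> by Vandermonde.\<close>

lemma gauss_binom_saalschuetz:
  fixes q :: "'a::real_normed_field"
  assumes q: "norm q < 1" and c: "c \<le> B"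
  shows "(\<Sum>k\<le>B - c. q ^ (k * (k + c)) * gauss_binom q (A + B + N - k) (A + B) * gauss_binom q A k * gauss_binom q B (k + c))
       = gauss_binom q (A + N + c) N * gauss_binom q (B + N) (N + c)"
proof -
  define d where "d = B - c"
  have B: "B = d + c" using c by (simp add: d_def)
  let ?e = "\<lambda>y. q ^ (y * (N + y - d))"
  \<comment> \<open>Splitting the upper entry as (N + A + c) + (d - k) leaves the Vandermonde
    exponent y (N + y - d).\<close>
  have exp1: "gauss_binom q (A + B + N - k) (A + B)
      = (\<Sum>y\<le>d. ?e y * gauss_binom q (d - k) y * gauss_binom q (N + A + c) (A + B - y))" if k: "k \<le> d" for k
  proof -
    have "A + B + N - k = (N + A + c) + (d - k)" using k B by simp
    then have "gauss_binom q (A + B + N - k) (A + B)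
      = (\<Sum>y\<le>A + B. q ^ (y * (N + A + c + y - (A + B))) * gauss_binom q (d - k) y * gauss_binom q (N + A + c) (A + B - y))"
      using gauss_binom_vandermonde[OF q] by metis
    also have "\<dots> = (\<Sum>y\<le>d. q ^ (y * (N + A + c + y - (A + B))) * gauss_binom q (d - k) y * gauss_binom q (N + A + c) (A + B - y))"
      by (rule sum.mono_neutral_right) (auto simp: B)
    also have "\<dots> = (\<Sum>y\<le>d. ?e y * gauss_binom q (d - k) y * gauss_binom q (N + A + c) (A + B - y))"
      by (intro sum.cong refl arg_cong2[where f = "(*)"] arg_cong2[where f = "(^)"]) (auto simp: B)
    finally show ?thesis .
  qed
  \<comment> \<open>This collects the dependence on \<open>k\<close> in one binomial, so that the
    sum over \<open>k\<close> becomes the shifted Vandermonde sum with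
    \<open>D = B - y\<close>.\<close>
  have rev1: "gauss_binom q B (k + c) * gauss_binom q (d - k) y = gauss_binom q B y * gauss_binom q (B - y) (k + c)"
    if "k \<le> d" "y \<le> d" for k y
  proof (cases "k + y \<le> d")
    case True
    then obtain z where "d = k + y + z" by (metis le_Suc_ex)
    then show ?thesis using gauss_binom_trinomial_revision[OF q, of "k + c" y z] by (simp add: B ac_simps)
  next
    case False
    then show ?thesis using that by (simp add: B)
  qed
  \<comment> \<open>The sum over \<open>k\<close> yields a binomial with upper entry
    \<open>A + B - y\<close>; this extracts a factor free of \<open>y\<close>, and what is left is a
    Vandermonde sum over \<open>y\<close>.\<close>
  have rev2: "gauss_binom q (N + A + c) (A + B - y) * gauss_binom q (A + B - y) (A + c) =
       gauss_binom q (N + A + c) (A + c) * gauss_binom q N (d - y)" if y: "y \<le> d" for y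
  proof (cases "d - y \<le> N")
    case True
    define z where "z = N - (d - y)"
    have e: "N = (d - y) + z" "A + B - y = (A + c) + (d - y)"
      using True y B by (auto simp: z_def)
    have 1: "gauss_binom q (N + A + c) (A + B - y) = gauss_binom q (z + (d - y) + (A + c)) z"
      using gauss_binom_sym[OF q, of "z" "z + (d - y) + (A + c)"] e by (simp add: ac_simps)
    have 2: "gauss_binom q (A + B - y) (A + c) = gauss_binom q ((d - y) + (A + c)) (d - y)"
      using gauss_binom_sym_add[OF q, of "d - y" "A + c"] e by (simp add: ac_simps)
    have 3: "gauss_binom q (N + A + c) (A + c) = gauss_binom q (z + (d - y) + (A + c)) (z + (d - y))"
      using gauss_binom_sym_add[OF q, of "z + (d - y)" "A + c"] e by (simp add: ac_simps)
    show ?thesis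
      unfolding e(1)[symmetric] 1 2 3
      using q e by (simp add: gauss_binom_eq qfac_nonzero ac_simps)
  next
    case False
    then show ?thesis using y by (simp add: B)
  qed
  have "(\<Sum>k\<le>B - c. q ^ (k * (k + c)) * gauss_binom q (A + B + N - k) (A + B) * gauss_binom q A k * gauss_binom q B (k + c))
     = (\<Sum>k\<le>d. \<Sum>y\<le>d. ?e y * gauss_binom q (N + A + c) (A + B - y) * gauss_binom q B y *
           (q ^ (k * (k + c)) * gauss_binom q A k * gauss_binom q (B - y) (k + c)))"
    unfolding d_def[symmetric]
  proof (rule sum.cong[OF refl])
    fix k assume "k \<in> {..d}"
    then have k: "k \<le> d" by simp
    show "q ^ (k * (k + c)) * gauss_binom q (A + B + N - k) (A + B) * gauss_binom q A k * gauss_binom q B (k + c)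
      = (\<Sum>y\<le>d. ?e y * gauss_binom q (N + A + c) (A + B - y) * gauss_binom q B y *
           (q ^ (k * (k + c)) * gauss_binom q A k * gauss_binom q (B - y) (k + c)))"
      unfolding exp1[OF k] sum_distrib_left sum_distrib_right
    proof (rule sum.cong[OF refl])
      fix y assume "y \<in> {..d}"
      then have "y \<le> d" by simp
      from rev1[OF k this]
      show "q ^ (k * (k + c)) * (?e y * gauss_binom q (d - k) y * gauss_binom q (N + A + c) (A + B - y)) * gauss_binom q A k * gauss_binom q B (k + c)
        = ?e y * gauss_binom q (N + A + c) (A + B - y) * gauss_binom q B y * (q ^ (k * (k + c)) * gauss_binom q A k * gauss_binom q (B - y) (k + c))"
        by (simp add: mult_ac)
    qed
  qed
  also have "\<dots> = (\<Sum>y\<le>d. ?e y * gauss_binom q (N + A + c) (A + B - y) * gauss_binom q B y *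
           (\<Sum>k\<le>d. q ^ (k * (k + c)) * gauss_binom q A k * gauss_binom q (B - y) (k + c)))"
    by (subst sum.swap) (simp add: sum_distrib_left)
  also have "\<dots> = (\<Sum>y\<le>d. gauss_binom q (N + A + c) (A + c) * (q ^ (y * (N + y - d)) * gauss_binom q B y * gauss_binom q N (d - y)))"
  proof (rule sum.cong[OF refl])
    fix y assume "y \<in> {..d}"
    then have y: "y \<le> d" by simp
    have "(\<Sum>k\<le>d. q ^ (k * (k + c)) * gauss_binom q A k * gauss_binom q (B - y) (k + c)) = gauss_binom q (A + B - y) (A + c)"
      using gauss_binom_vandermonde_shift[OF q, of A d "B - y" c] y by (simp add: B)
    with rev2[OF y]
    show "?e y * gauss_binom q (N + A + c) (A + B - y) * gauss_binom q B y *
           (\<Sum>k\<le>d. q ^ (k * (k + c)) * gauss_binom q A k * gauss_binom q (B - y) (k + c)) =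
        gauss_binom q (N + A + c) (A + c) * (q ^ (y * (N + y - d)) * gauss_binom q B y * gauss_binom q N (d - y))"
      by (simp add: mult_ac)
  qed
  also have "\<dots> = gauss_binom q (N + A + c) (A + c) * gauss_binom q (N + B) d"
    by (simp only: sum_distrib_left[symmetric] gauss_binom_vandermonde[OF q, symmetric])
  also have "gauss_binom q (N + A + c) (A + c) = gauss_binom q (A + N + c) N"
    using gauss_binom_sym_add[OF q, of N "A + c"] by (simp add: ac_simps)
  also have "gauss_binom q (N + B) d = gauss_binom q (B + N) (N + c)"
    using gauss_binom_sym_add[OF q, of "N + c" d] by (simp add: B ac_simps)
  finally show ?thesis .
qed

section \<open>The Burge transform\<close>

lemma coeff_prod_linear:
  fixes q c :: "'a::real_normed_field"
  assumes q: "norm q < 1"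
  shows "coeff (\<Prod>i<n. [:1, c * q ^ i:]) k = c ^ k * q ^ (k choose 2) * gauss_binom q n k"
proof (induction n arbitrary: k)
  case 0
  then show ?case by (cases k) (auto simp: numeral_2_eq_2)
next
  case (Suc n)
  show ?case
  proof (cases k)
    case 0
    then show ?thesis using Suc[of 0] by (simp add: mult.commute)
  next
    case (Suc k')
    have "coeff (\<Prod>i<Suc n. [:1, c * q ^ i:]) k
        = coeff (\<Prod>i<n. [:1, c * q ^ i:]) (Suc k') + c * q ^ n * coeff (\<Prod>i<n. [:1, c * q ^ i:]) k'"
      by (simp add: Suc mult.commute[of "prod _ _"])
    also have "\<dots> = c ^ k * (q ^ (k choose 2) * gauss_binom q n k + q ^ (n + (k' choose 2)) * gauss_binom q n k')"
      unfolding Suc.IH Suc by (simp add: algebra_simps power_add)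
    also have "q ^ (n + (k' choose 2)) * gauss_binom q n k' = q ^ (k choose 2) * (q ^ (n - k') * gauss_binom q n k')"
    proof (cases "k' \<le> n")
      case True
      then have "n + (k' choose 2) = (k choose 2) + (n - k')"
        by (simp add: Suc numeral_2_eq_2)
      then show ?thesis by (simp add: power_add)
    qed simp
    finally show ?thesis
      unfolding Suc gauss_binom_Suc'[OF q] by (simp add: algebra_simps)
  qed
qed

lemma coeff_prod_even_quadratic:
  fixes q c :: "'a::real_normed_field"
  assumes q: "norm q < 1"
  shows "coeff (\<Prod>i<n. [:1, 0, c * q ^ i:]) (2 * k) = c ^ k * q ^ (k choose 2) * gauss_binom q n k"
proof -
  have "(\<Prod>i<n. [:1, 0, c * q ^ i:]) = pcompose (\<Prod>i<n. [:1, c * q ^ i:]) [:0, 0, 1:]"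
    by (simp add: pcompose_prod pcompose_pCons)
  moreover have "coeff (pcompose p [:0, 0, 1:]) (2 * k) = coeff p k" for p :: "'a poly"
  proof (induction p arbitrary: k)
    case (pCons x p)
    then show ?case by (cases k) (auto simp: pcompose_pCons)
  qed simp
  ultimately show ?thesis by (simp add: coeff_prod_linear[OF q])
qed

lemma sum_fold_symmetric:
  fixes T :: "nat \<Rightarrow> 'a::comm_monoid_add"
  shows "(\<Sum>i\<le>2 * M. T i) = T M + (\<Sum>j=1..M. T (M + j) + T (M - j))"
proof -
  have "(\<Sum>i\<le>2 * M. T i) = (\<Sum>i\<in>{M} \<union> ({M + 1..2 * M} \<union> {..<M}). T i)"
    by (rule sum.cong) auto
  also have "\<dots> = T M + ((\<Sum>i\<in>{M + 1..2 * M}. T i) + (\<Sum>i<M. T i))"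
    by (subst sum.union_disjoint; (subst sum.union_disjoint)?) auto
  also have "(\<Sum>i\<in>{M + 1..2 * M}. T i) = (\<Sum>j=1..M. T (M + j))"
    by (rule sum.reindex_bij_witness[of _ "\<lambda>j. M + j" "\<lambda>i. i - M"]) auto
  also have "(\<Sum>i<M. T i) = (\<Sum>j=1..M. T (M - j))"
    by (rule sum.reindex_bij_witness[of _ "\<lambda>j. M - j" "\<lambda>i. M - i"]) auto
  finally show ?thesis by (simp add: sum.distrib)
qed

text \<open>\<open>bilateral_weight\<close> folds a sum over \<open>\<int>\<close> with sign \<open>(-1) ^ j\<close>, symmetric in \<open>j\<close>, to \<open>j \<ge> 0\<close>.\<close>

definition bilateral_weight :: "nat \<Rightarrow> 'a::comm_ring_1" where
  "bilateral_weight j = (if j = 0 then 1 else 2 * (- 1) ^ j)"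

lemma sum_bilateral_weight:
  fixes f :: "nat \<Rightarrow> 'a::comm_ring_1"
  shows "(\<Sum>j\<le>M. bilateral_weight j * f j) = f 0 + (\<Sum>j=1..M. 2 * (- 1) ^ j * f j)"
proof -
  have "{..M} = insert 0 {1..M}" by auto
  then have "(\<Sum>j\<le>M. bilateral_weight j * f j) = f 0 + (\<Sum>j=1..M. bilateral_weight j * f j)"
    by (simp add: bilateral_weight_def)
  also have "(\<Sum>j=1..M. bilateral_weight j * f j) = (\<Sum>j=1..M. 2 * (- 1) ^ j * f j)"
    by (rule sum.cong) (auto simp: bilateral_weight_def)
  finally show ?thesis .
qed

lemma choose_two_add_diff:
  assumes "j \<le> M"
  shows "((M + j) choose 2) + ((M - j) choose 2) = 2 * (M choose 2) + j\<^sup>2"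
proof -
  obtain d where M: "M = j + d" using assms le_Suc_ex by blast
  have t: "2 * (x choose 2) = x * (x - 1)" for x :: nat
    by (cases x) (simp_all add: choose_two)
  have "2 * (((M + j) choose 2) + ((M - j) choose 2)) = 2 * (2 * (M choose 2) + j\<^sup>2)"
    unfolding distrib_left t by (cases d; cases j) (auto simp: M t algebra_simps power2_eq_square)
  then show ?thesis by simp
qed

text \<open>Compare the coefficients of X^(2M) in the product over i < n of (1 - q^i X)(1 + q^i X) =
  1 - q^(2i) X^2, using the \<open>q\<close>-binomial theorem in base \<open>q\<close> on the left
  and in base \<open>q\<^sup>2\<close> on the right. Terms at equal distance j from the middle index
  M coincide.\<close>

lemma sum_gauss_binom_product_gauss_binom_square:
  fixes q :: "'a::real_normed_field"
  assumes q: "norm q < 1" and M: "M \<le> n"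
  shows "(\<Sum>j\<le>M. bilateral_weight j * (q ^ j\<^sup>2 * (gauss_binom q n (M - j) * gauss_binom q n (M + j)))) = gauss_binom (q\<^sup>2) n M"
    (is "?lhs = _")
proof (cases "q = 0")
  case True
  \<comment> \<open>The main argument cancels a power of \<open>q\<close>. At \<open>q = 0\<close>
    only \<open>j = 0\<close> survives, and all binomials involved are 1.\<close>
  have g: "gauss_binom 0 n k = (1::'a)" if "k \<le> n" for n k
    using that
  proof (induction n arbitrary: k)
    case (Suc n)
    then show ?case by (cases k) auto
  qed simp
  have "?lhs = (\<Sum>j\<in>{0}. bilateral_weight j * (q ^ j\<^sup>2 * (gauss_binom q n (M - j) * gauss_binom q n (M + j))))"
    by (rule sum.mono_neutral_right) (auto simp: True)
  then show ?thesis using M by (simp add: True g bilateral_weight_def)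
next
  case False
  let ?P = "\<lambda>c. \<Prod>i<n. [:1, c * q ^ i:]"
  define T where "T i = coeff (?P (- 1)) i * coeff (?P 1) (2 * M - i)" for i
  define f where "f j = q ^ j\<^sup>2 * (gauss_binom q n (M - j) * gauss_binom q n (M + j))" for j
  let ?u = "(- 1) ^ M * q ^ (2 * (M choose 2))"
  have q2: "norm (q\<^sup>2) < 1"
    using q by (simp add: norm_power power_less_one_iff)
  have "?P (- 1) * ?P 1 = (\<Prod>i<n. [:1, 0, (- 1) * (q\<^sup>2) ^ i:])"
    unfolding prod.distrib[symmetric]
    by (rule prod.cong) (auto simp: power_mult[symmetric] power_add[symmetric] mult_2)
  then have "(\<Sum>i\<le>2 * M. T i) = ?u * gauss_binom (q\<^sup>2) n M"
    unfolding T_def coeff_mult[symmetric]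
    using coeff_prod_even_quadratic[OF q2, of "-1" n M] by (simp add: power_mult)
  moreover have "(\<Sum>i\<le>2 * M. T i) = ?u * (f 0 + (\<Sum>j=1..M. 2 * (- 1) ^ j * f j))"
  proof -
    have T: "T (M + j) = ?u * (- 1) ^ j * f j" "T (M - j) = ?u * (- 1) ^ j * f j" if "j \<le> M" for j
    proof -
      have "(- 1 :: 'a) ^ (M - j) = (- 1) ^ (M + j)"
        using that by (auto simp: minus_one_power_iff)
      moreover have "2 * M - (M + j) = M - j" "2 * M - (M - j) = M + j" using that by auto
      moreover have "q ^ ((M + j) choose 2) * q ^ ((M - j) choose 2) = q ^ (2 * (M choose 2)) * q ^ j\<^sup>2"
        unfolding power_add[symmetric] choose_two_add_diff[OF that] ..
      ultimately show "T (M + j) = ?u * (- 1) ^ j * f j" "T (M - j) = ?u * (- 1) ^ j * f j"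
        unfolding T_def coeff_prod_linear[OF q] f_def
        by (simp_all add: power_add mult_ac)
    qed
    show ?thesis
      unfolding sum_fold_symmetric using T[of 0]
      by (simp add: T distrib_left sum_distrib_left mult_ac)
  qed
  ultimately have "f 0 + (\<Sum>j=1..M. 2 * (- 1) ^ j * f j) = gauss_binom (q\<^sup>2) n M"
    using False by simp
  then show ?thesis
    unfolding f_def[symmetric] sum_bilateral_weight .
qed

text \<open>
  The factors are the \<open>q\<close>-binomials \<open>[L+M+a-b; L+a]\<close> and \<open>[L+M-a+b; L-a]\<close>; natural \<open>a\<close>, \<open>b\<close> suffice
  because the product is invariant under \<open>(a,b) \<mapsto> (-a,-b)\<close>. The suffix \<open>inf\<close> marks the limit
  \<open>L \<rightarrow> \<infinity>\<close>.
\<close>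

definition burge_product :: "'a::comm_ring_1 \<Rightarrow> nat \<Rightarrow> nat \<Rightarrow> nat \<Rightarrow> nat \<Rightarrow> 'a" where
  "burge_product q L M a b = (if a \<le> L \<and> b \<le> M
     then gauss_binom q (L + a + (M - b)) (M - b) * gauss_binom q (L - a + (M + b)) (M + b) else 0)"

definition burge_product_inf :: "'a::real_normed_field \<Rightarrow> nat \<Rightarrow> nat \<Rightarrow> 'a" where
  "burge_product_inf q M b = (if b \<le> M then 1 / (qfac q (M - b) * qfac q (M + b)) else 0)"

text \<open>The limit \<open>L + M\<close> is symmetric in both arguments and lies beyond the
  support as soon as one of \<alpha>, \<beta> is positive. It also equals \<open>L\<close> for the
  arguments \<open>L - i\<close> and \<open>i\<close>, which gives all sums in a Burge step one
  common range.\<close>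

definition burge_sum :: "'a::comm_ring_1 \<Rightarrow> nat \<Rightarrow> nat \<Rightarrow> nat \<Rightarrow> nat \<Rightarrow> 'a" where
  "burge_sum q \<alpha> \<beta> L M = (\<Sum>j\<le>L + M. bilateral_weight j * (q ^ (\<alpha> * \<beta> * j\<^sup>2) * burge_product q L M (\<alpha> * j) (\<beta> * j)))"

definition burge_sum_inf :: "'a::real_normed_field \<Rightarrow> nat \<Rightarrow> nat \<Rightarrow> nat \<Rightarrow> 'a" where
  "burge_sum_inf q \<alpha> \<beta> M = (\<Sum>j\<le>M. bilateral_weight j * (q ^ (\<alpha> * \<beta> * j\<^sup>2) * burge_product_inf q M (\<beta> * j)))"

section \<open>Exchange symmetry and Euclidean subtraction\<close>

lemma burge_product_eqI:
  assumes "a \<le> L" "b \<le> M" "L + a + (M - b) = x" "M - b = y" "L - a + (M + b) = z" "M + b = w"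
  shows "burge_product q L M a b = gauss_binom q x y * gauss_binom q z w"
  using assms by (simp add: burge_product_def)

lemma burge_product_swap:
  fixes q :: "'a::real_normed_field"
  assumes q: "norm q < 1"
  shows "burge_product q L M a b = burge_product q M L b a"
  unfolding burge_product_def gauss_binom_sym_add[OF q, of "L - a" "M + b"] gauss_binom_sym_add[OF q, of "L + a" "M - b"]
  by (simp only: add.commute[of "M - b"] add.commute[of "M + b"] mult.commute conj_commute)

lemma burge_sum_swap:
  fixes q :: "'a::real_normed_field"
  assumes q: "norm q < 1"
  shows "burge_sum q \<alpha> \<beta> L M = burge_sum q \<beta> \<alpha> M L"
  unfolding burge_sum_def by (subst burge_product_swap[OF q]) (simp add: ac_simps)

text \<open>Permits any upper limit beyond the support: past it, \<open>\<alpha> * j\<close> exceeds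
  \<open>L\<close> or \<open>\<beta> * j\<close> exceeds \<open>M\<close>.\<close>

lemma burge_sum_eq_sum:
  assumes "1 \<le> \<alpha> \<and> L \<le> K \<or> 1 \<le> \<beta> \<and> M \<le> K"
  shows "burge_sum q \<alpha> \<beta> L M = (\<Sum>j\<le>K. bilateral_weight j * (q ^ (\<alpha> * \<beta> * j\<^sup>2) * burge_product q L M (\<alpha> * j) (\<beta> * j)))"
proof -
  have z: "burge_product q L M (\<alpha> * j) (\<beta> * j) = 0" if "1 \<le> \<alpha> \<and> L < j \<or> 1 \<le> \<beta> \<and> M < j" for j
  proof -
    have "1 * j \<le> x * j" if "1 \<le> x" for x
      using that by (intro mult_right_mono) auto
    with that have "L < \<alpha> * j \<or> M < \<beta> * j" by (metis less_le_trans mult_1)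
    then show ?thesis by (auto simp: burge_product_def)
  qed
  have z: "burge_product q L M (\<alpha> * j) (\<beta> * j) = 0" if "\<not> j \<le> K \<or> \<not> j \<le> L + M" for j
    by (rule z) (use assms that in auto)
  let ?t = "\<lambda>j. bilateral_weight j * (q ^ (\<alpha> * \<beta> * j\<^sup>2) * burge_product q L M (\<alpha> * j) (\<beta> * j))"
  let ?X = "max K (L + M)"
  have "burge_sum q \<alpha> \<beta> L M = (\<Sum>j\<le>?X. ?t j)"
    unfolding burge_sum_def
    by (rule sum.mono_neutral_left) (use z in fastforce)+
  also have "\<dots> = (\<Sum>j\<le>K. ?t j)"
    by (rule sum.mono_neutral_right) (use z in fastforce)+
  finally show ?thesis .
qed

text \<open>For equal shifts both Gaussian binomials have upper entry \<open>L + M\<close>, so the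
  alternating convolution applies. This is where the Euclidean algorithm stops.\<close>

lemma burge_sum_1_1:
  fixes q :: "'a::real_normed_field"
  assumes q: "norm q < 1"
  shows "burge_sum q 1 1 L M = gauss_binom (q\<^sup>2) (L + M) M"
proof -
  have "burge_sum q 1 1 L M = (\<Sum>j\<le>M. bilateral_weight j * (q ^ j\<^sup>2 * burge_product q L M j j))"
    using burge_sum_eq_sum[of 1 L M 1 M q] by simp
  also have "\<dots> = (\<Sum>j\<le>M. bilateral_weight j * (q ^ j\<^sup>2 * (gauss_binom q (L + M) (M - j) * gauss_binom q (L + M) (M + j))))"
    by (intro sum.cong refl arg_cong2[where f = "(*)"]) (auto simp: burge_product_def)
  finally show ?thesis using sum_gauss_binom_product_gauss_binom_square[OF q, of M "L + M"] by simp
qed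

text \<open>With L = a + b + d, M = b + N and i = b + k this is the Saalschuetz sum for A = 2a + d,
  B = 2b + d and shift c = 2b. If no such d or N exists, every term vanishes.\<close>

lemma burge_product_burge:
  fixes q :: "'a::real_normed_field"
  assumes q: "norm q < 1"
  shows "q ^ b\<^sup>2 * burge_product q L M (a + b) b =
    (\<Sum>i\<le>L. q ^ i\<^sup>2 * gauss_binom q (2 * L + M - i) (2 * L) * burge_product q (L - i) i a b)"
proof (cases "a + b \<le> L \<and> b \<le> M")
  case True
  then obtain d N where L: "L = a + b + d" and M: "M = b + N" by (metis le_Suc_ex)
  let ?t = "\<lambda>i. q ^ i\<^sup>2 * gauss_binom q (2 * L + M - i) (2 * L) * burge_product q (L - i) i a b"
  have "(\<Sum>i\<le>L. ?t i) = (\<Sum>i\<in>{b..b + d}. ?t i)"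
    by (rule sum.mono_neutral_right) (auto simp: burge_product_def L)
  also have "\<dots> = (\<Sum>k\<le>d. ?t (b + k))"
    by (rule sum.reindex_bij_witness[of _ "\<lambda>k. b + k" "\<lambda>i. i - b"]) auto
  also have "\<dots> = (\<Sum>k\<le>d. q ^ b\<^sup>2 * (q ^ (k * (k + 2 * b)) *
      gauss_binom q ((2 * a + d) + (2 * b + d) + N - k) ((2 * a + d) + (2 * b + d)) *
      gauss_binom q (2 * a + d) k * gauss_binom q (2 * b + d) (k + 2 * b)))"
  proof (rule sum.cong[OF refl])
    fix k assume "k \<in> {..d}"
    then have k: "k \<le> d" by simp
    have "(b + k)\<^sup>2 = b\<^sup>2 + k * (k + 2 * b)"
      by (simp add: power2_eq_square algebra_simps)
    moreover have "2 * L + M - (b + k) = (2 * a + d) + (2 * b + d) + N - k"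
      "2 * L = (2 * a + d) + (2 * b + d)"
      by (auto simp: L M)
    moreover have "burge_product q (L - (b + k)) (b + k) a b = gauss_binom q (2 * a + d) k * gauss_binom q (2 * b + d) (k + 2 * b)"
      using k by (intro burge_product_eqI) (auto simp: L)
    ultimately show "?t (b + k) = q ^ b\<^sup>2 * (q ^ (k * (k + 2 * b)) *
      gauss_binom q ((2 * a + d) + (2 * b + d) + N - k) ((2 * a + d) + (2 * b + d)) *
      gauss_binom q (2 * a + d) k * gauss_binom q (2 * b + d) (k + 2 * b))"
      by (simp add: power_add mult_ac)
  qed
  also have "\<dots> = q ^ b\<^sup>2 * (gauss_binom q (2 * a + d + N + 2 * b) N * gauss_binom q (2 * b + d + N) (N + 2 * b))"
    using gauss_binom_saalschuetz[OF q, of "2 * b" "2 * b + d" "2 * a + d" N]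
    by (simp add: sum_distrib_left[symmetric] del: add_mult_distrib2)
  also have "gauss_binom q (2 * a + d + N + 2 * b) N * gauss_binom q (2 * b + d + N) (N + 2 * b) = burge_product q L M (a + b) b"
    using True by (intro burge_product_eqI[symmetric]) (auto simp: L M)
  finally show ?thesis ..
next
  case False
  have "gauss_binom q (2 * L + M - i) (2 * L) * burge_product q (L - i) i a b = 0" if "i \<le> L" for i
  proof (cases "M < i")
    case True
    then show ?thesis using that by (simp add: burge_product_def)
  next
    case False
    with \<open>\<not> (a + b \<le> L \<and> b \<le> M)\<close> that show ?thesis by (auto simp: burge_product_def)
  qed
  then have "(\<Sum>i\<le>L. q ^ i\<^sup>2 * gauss_binom q (2 * L + M - i) (2 * L) * burge_product q (L - i) i a b) = 0"
    by (intro sum.neutral) (auto simp: mult.assoc)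
  moreover have "burge_product q L M (a + b) b = 0" using False by (auto simp: burge_product_def)
  ultimately show ?thesis by simp
qed

text \<open>Since (\<alpha> + \<beta>) \<beta> j^2 = \<alpha> \<beta> j^2 + (\<beta> j)^2, the
  transform with b = \<beta> j applies term by term.\<close>

lemma burge_sum_burge:
  fixes q :: "'a::real_normed_field"
  assumes q: "norm q < 1" and "1 \<le> \<alpha>"
  shows "burge_sum q (\<alpha> + \<beta>) \<beta> L M = (\<Sum>i\<le>L. q ^ i\<^sup>2 * gauss_binom q (2 * L + M - i) (2 * L) * burge_sum q \<alpha> \<beta> (L - i) i)"
proof -
  have "burge_sum q (\<alpha> + \<beta>) \<beta> L M =
      (\<Sum>j\<le>L. bilateral_weight j * (q ^ ((\<alpha> + \<beta>) * \<beta> * j\<^sup>2) * burge_product q L M ((\<alpha> + \<beta>) * j) (\<beta> * j)))"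
    using assms by (intro burge_sum_eq_sum) auto
  also have "\<dots> = (\<Sum>j\<le>L. bilateral_weight j * (q ^ (\<alpha> * \<beta> * j\<^sup>2) *
      (q ^ (\<beta> * j)\<^sup>2 * burge_product q L M (\<alpha> * j + \<beta> * j) (\<beta> * j))))"
    by (simp add: algebra_simps power_add power2_eq_square)
  also have "\<dots> = (\<Sum>j\<le>L. \<Sum>i\<le>L. q ^ i\<^sup>2 * gauss_binom q (2 * L + M - i) (2 * L) *
      (bilateral_weight j * (q ^ (\<alpha> * \<beta> * j\<^sup>2) * burge_product q (L - i) i (\<alpha> * j) (\<beta> * j))))"
    unfolding burge_product_burge[OF q] sum_distrib_left by (intro sum.cong refl) (simp add: mult_ac)
  also have "\<dots> = (\<Sum>i\<le>L. q ^ i\<^sup>2 * gauss_binom q (2 * L + M - i) (2 * L) *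
      (\<Sum>j\<le>L. bilateral_weight j * (q ^ (\<alpha> * \<beta> * j\<^sup>2) * burge_product q (L - i) i (\<alpha> * j) (\<beta> * j))))"
    by (subst sum.swap) (simp add: sum_distrib_left)
  also have "\<dots> = (\<Sum>i\<le>L. q ^ i\<^sup>2 * gauss_binom q (2 * L + M - i) (2 * L) * burge_sum q \<alpha> \<beta> (L - i) i)"
    by (intro sum.cong refl arg_cong2[where f = "(*)"]) (simp add: burge_sum_def)
  finally show ?thesis .
qed

text \<open>The case M = \<infinity> of the Burge transform: the binomial in front becomes
  1/(q)_(2L), and by symmetry the product on the left depends only on the shift \<open>a + b\<close>
  of the finite argument. Vandermonde takes the place of Saalschuetz.\<close>

lemma burge_product_inf_burge:
  fixes q :: "'a::real_normed_field"
  assumes q: "norm q < 1"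
  shows "q ^ b\<^sup>2 * burge_product_inf q L (a + b) = (\<Sum>i\<le>L. q ^ i\<^sup>2 * burge_product q (L - i) i a b) / qfac q (2 * L)"
proof (cases "a + b \<le> L")
  case True
  then obtain d where L: "L = a + b + d" by (metis le_Suc_ex)
  let ?t = "\<lambda>i. q ^ i\<^sup>2 * burge_product q (L - i) i a b"
  have "(\<Sum>i\<le>L. ?t i) = (\<Sum>i\<in>{b..b + d}. ?t i)"
    by (rule sum.mono_neutral_right) (auto simp: burge_product_def L)
  also have "\<dots> = (\<Sum>k\<le>d. ?t (b + k))"
    by (rule sum.reindex_bij_witness[of _ "\<lambda>k. b + k" "\<lambda>i. i - b"]) auto
  also have "\<dots> = (\<Sum>k\<le>d. q ^ b\<^sup>2 * (q ^ (k * (k + 2 * b)) *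
      gauss_binom q (2 * a + d) k * gauss_binom q (2 * b + d) (k + 2 * b)))"
  proof (rule sum.cong[OF refl])
    fix k assume "k \<in> {..d}"
    then have k: "k \<le> d" by simp
    have "(b + k)\<^sup>2 = b\<^sup>2 + k * (k + 2 * b)"
      by (simp add: power2_eq_square algebra_simps)
    moreover have "burge_product q (L - (b + k)) (b + k) a b = gauss_binom q (2 * a + d) k * gauss_binom q (2 * b + d) (k + 2 * b)"
      using k by (intro burge_product_eqI) (auto simp: L)
    ultimately show "?t (b + k) = q ^ b\<^sup>2 * (q ^ (k * (k + 2 * b)) *
      gauss_binom q (2 * a + d) k * gauss_binom q (2 * b + d) (k + 2 * b))"
      by (simp add: power_add mult_ac)
  qed
  also have "\<dots> = q ^ b\<^sup>2 * gauss_binom q (2 * a + d + (2 * b + d)) (2 * a + d + 2 * b)"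
    using gauss_binom_vandermonde_shift[OF q, of "2 * a + d" d "2 * b + d" "2 * b"]
    by (simp add: sum_distrib_left[symmetric])
  also have "gauss_binom q (2 * a + d + (2 * b + d)) (2 * a + d + 2 * b) = qfac q (2 * L) * burge_product_inf q L (a + b)"
  proof -
    have "2 * a + d + (2 * b + d) = 2 * L" "2 * a + d + 2 * b = L + (a + b)"
      "2 * L - (L + (a + b)) = L - (a + b)"
      by (auto simp: L)
    then have "gauss_binom q (2 * a + d + (2 * b + d)) (2 * a + d + 2 * b) =
        qfac q (2 * L) / (qfac q (L + (a + b)) * qfac q (L - (a + b)))"
      using gauss_binom_eq[OF q, of "L + (a + b)" "2 * L"] True by (simp only:)
    then show ?thesis using True by (simp add: burge_product_inf_def mult.commute)
  qed
  finally show ?thesis using qfac_nonzero[OF q] by simp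
next
  case False
  then have "burge_product q (L - i) i a b = 0" if "i \<le> L" for i
    using that by (auto simp: burge_product_def)
  with False show ?thesis by (simp add: burge_product_inf_def)
qed

lemma burge_sum_inf_burge:
  fixes q :: "'a::real_normed_field"
  assumes q: "norm q < 1"
  shows "burge_sum_inf q \<beta> (\<alpha> + \<beta>) L = (\<Sum>i\<le>L. q ^ i\<^sup>2 * burge_sum q \<alpha> \<beta> (L - i) i) / qfac q (2 * L)"
proof -
  have "burge_sum_inf q \<beta> (\<alpha> + \<beta>) L = (\<Sum>j\<le>L. bilateral_weight j * (q ^ (\<alpha> * \<beta> * j\<^sup>2) *
      (q ^ (\<beta> * j)\<^sup>2 * burge_product_inf q L (\<alpha> * j + \<beta> * j))))"
    by (simp add: burge_sum_inf_def algebra_simps power_add power2_eq_square)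
  also have "\<dots> = (\<Sum>j\<le>L. \<Sum>i\<le>L. q ^ i\<^sup>2 *
      (bilateral_weight j * (q ^ (\<alpha> * \<beta> * j\<^sup>2) * burge_product q (L - i) i (\<alpha> * j) (\<beta> * j)))) / qfac q (2 * L)"
    unfolding burge_product_inf_burge[OF q] sum_distrib_left sum_divide_distrib
    by (intro sum.cong refl) (simp add: mult_ac)
  also have "\<dots> = (\<Sum>i\<le>L. q ^ i\<^sup>2 *
      (\<Sum>j\<le>L. bilateral_weight j * (q ^ (\<alpha> * \<beta> * j\<^sup>2) * burge_product q (L - i) i (\<alpha> * j) (\<beta> * j)))) / qfac q (2 * L)"
    by (subst sum.swap) (simp add: sum_distrib_left)
  also have "\<dots> = (\<Sum>i\<le>L. q ^ i\<^sup>2 * burge_sum q \<alpha> \<beta> (L - i) i) / qfac q (2 * L)"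
    by (intro arg_cong2[where f = "(/)"] sum.cong refl arg_cong2[where f = "(*)"]) (simp add: burge_sum_def)
  finally show ?thesis .
qed

section \<open>Limits\<close>

definition qfac_inf :: "'a::{real_normed_field,banach} \<Rightarrow> 'a" where
  "qfac_inf q = prodinf (\<lambda>i. 1 - q ^ Suc i)"

lemma summable_norm_power_Suc:
  fixes x q :: "'a::real_normed_field"
  assumes "norm q < 1"
  shows "summable (\<lambda>i. norm (x * q ^ i))"
  using assms by (auto simp: norm_mult norm_power intro!: summable_mult summable_geometric)

lemma convergent_prod_qpoch:
  fixes x q :: "'a::{real_normed_field,banach}"
  assumes "norm q < 1"
  shows "convergent_prod (\<lambda>i. 1 - x * q ^ i)"
proof -
  have "summable (\<lambda>i. norm ((1 - x * q ^ i) - 1))"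
    using summable_norm_power_Suc[OF assms, of x] by simp
  then show ?thesis
    by (intro abs_convergent_prod_imp_convergent_prod summable_imp_abs_convergent_prod)
qed

lemma prod_qpoch_tendsto:
  fixes x q :: "'a::{real_normed_field,banach}"
  assumes "norm q < 1"
  shows "(\<lambda>n. \<Prod>i<n. 1 - x * q ^ i) \<longlonglongrightarrow> prodinf (\<lambda>i. 1 - x * q ^ i)"
  using convergent_prod_LIMSEQ[OF convergent_prod_qpoch[OF assms, of x]]
  by (subst LIMSEQ_lessThan_iff_atMost)

lemma qfac_tendsto:
  fixes q :: "'a::{real_normed_field,banach}"
  assumes "norm q < 1"
  shows "qfac q \<longlonglongrightarrow> qfac_inf q"
  using prod_qpoch_tendsto[OF assms, of q] by (simp add: qfac_def[abs_def] qfac_inf_def)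

lemma qfac_inf_nonzero:
  fixes q :: "'a::{real_normed_field,banach}"
  assumes "norm q < 1"
  shows "qfac_inf q \<noteq> 0"
  unfolding qfac_inf_def
proof (rule prodinf_nonzero)
  show "convergent_prod (\<lambda>i. 1 - q ^ Suc i)"
    using convergent_prod_qpoch[OF assms, of q] by simp
  show "1 - q ^ Suc i \<noteq> 0" for i
    using qfac_nonzero[OF assms, of "Suc i"] by (simp add: qfac_Suc)
qed

lemma qfac_add_tendsto:
  fixes q :: "'a::{real_normed_field,banach}"
  assumes "norm q < 1"
  shows "(\<lambda>n. qfac q (n + s)) \<longlonglongrightarrow> qfac_inf q"
  using LIMSEQ_ignore_initial_segment[OF qfac_tendsto[OF assms]] .

lemma qfac_diff_tendsto:
  fixes q :: "'a::{real_normed_field,banach}"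
  assumes "norm q < 1"
  shows "(\<lambda>n. qfac q (n - s)) \<longlonglongrightarrow> qfac_inf q"
  by (rule LIMSEQ_offset[of _ s]) (simp add: qfac_tendsto[OF assms])

lemma gauss_binom_tendsto:
  fixes q :: "'a::{real_normed_field,banach}"
  assumes q: "norm q < 1"
  shows "(\<lambda>n. gauss_binom q n k) \<longlonglongrightarrow> 1 / qfac q k"
proof -
  have "(\<lambda>n. qfac q n / (qfac q k * qfac q (n - k))) \<longlonglongrightarrow> qfac_inf q / (qfac q k * qfac_inf q)"
    using qfac_nonzero[OF q] qfac_inf_nonzero[OF q]
    by (intro tendsto_intros qfac_tendsto[OF q] qfac_diff_tendsto[OF q]) auto
  moreover have "\<forall>\<^sub>F n in sequentially. gauss_binom q n k = qfac q n / (qfac q k * qfac q (n - k))"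
    using eventually_ge_at_top[of k] by eventually_elim (simp add: gauss_binom_eq[OF q])
  ultimately show ?thesis
    using qfac_inf_nonzero[OF q] by (subst tendsto_cong) auto
qed

lemma gauss_binom_add_tendsto:
  fixes q :: "'a::{real_normed_field,banach}"
  assumes "norm q < 1"
  shows "(\<lambda>n. gauss_binom q (n + s) k) \<longlonglongrightarrow> 1 / qfac q k" "(\<lambda>n. gauss_binom q (s + n) k) \<longlonglongrightarrow> 1 / qfac q k"
  using LIMSEQ_ignore_initial_segment[OF gauss_binom_tendsto[OF assms, of k], of s]
  by (simp_all add: add.commute)

text \<open>The limit D \<rightarrow> \<infinity> of the shifted Vandermonde sum with
  \<open>A = N\<close>.\<close>

lemma sum_gauss_binom_div_qfac:
  fixes q :: "'a::{real_normed_field,banach}"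
  assumes q: "norm q < 1"
  shows "(\<Sum>k\<le>N. q ^ (k * (k + c)) * gauss_binom q N k / qfac q (k + c)) = 1 / qfac q (N + c)"
proof (rule LIMSEQ_unique)
  show "(\<lambda>D. \<Sum>k\<le>N. q ^ (k * (k + c)) * gauss_binom q N k * gauss_binom q D (k + c))
      \<longlonglongrightarrow> (\<Sum>k\<le>N. q ^ (k * (k + c)) * gauss_binom q N k / qfac q (k + c))"
    using gauss_binom_tendsto[OF q] by (auto intro!: tendsto_eq_intros)
  show "(\<lambda>D. \<Sum>k\<le>N. q ^ (k * (k + c)) * gauss_binom q N k * gauss_binom q D (k + c)) \<longlonglongrightarrow> 1 / qfac q (N + c)"
    using gauss_binom_add_tendsto(2)[OF q, of N "N + c"] by (subst gauss_binom_vandermonde_shift[OF q]) auto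
qed

text \<open>The case L = \<infinity> of the Burge transform, a step of the Bailey chain: the
  binomial in front equals [2L+M-i; M-i] and tends to 1/(q)_(M-i).\<close>

lemma burge_product_inf_chain:
  fixes q :: "'a::{real_normed_field,banach}"
  assumes q: "norm q < 1"
  shows "q ^ b\<^sup>2 * burge_product_inf q M b = (\<Sum>i\<le>M. q ^ i\<^sup>2 / qfac q (M - i) * burge_product_inf q i b)"
proof (cases "b \<le> M")
  case True
  then obtain N where M: "M = b + N" by (metis le_Suc_ex)
  let ?t = "\<lambda>i. q ^ i\<^sup>2 / qfac q (M - i) * burge_product_inf q i b"
  have "(\<Sum>i\<le>M. ?t i) = (\<Sum>i\<in>{b..b + N}. ?t i)"
    by (rule sum.mono_neutral_right) (auto simp: burge_product_inf_def M)
  also have "\<dots> = (\<Sum>k\<le>N. ?t (b + k))"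
    by (rule sum.reindex_bij_witness[of _ "\<lambda>k. b + k" "\<lambda>i. i - b"]) auto
  also have "\<dots> = (\<Sum>k\<le>N. q ^ b\<^sup>2 / qfac q N * (q ^ (k * (k + 2 * b)) * gauss_binom q N k / qfac q (k + 2 * b)))"
  proof (rule sum.cong[OF refl])
    fix k assume "k \<in> {..N}"
    then have k: "k \<le> N" by simp
    have "(b + k)\<^sup>2 = b\<^sup>2 + k * (k + 2 * b)"
      by (simp add: power2_eq_square algebra_simps)
    moreover have "qfac q (b + k + b) = qfac q (k + 2 * b)" by (rule arg_cong[where f = "qfac q"]) simp
    ultimately show "?t (b + k) = q ^ b\<^sup>2 / qfac q N * (q ^ (k * (k + 2 * b)) * gauss_binom q N k / qfac q (k + 2 * b))"
      using qfac_nonzero[OF q] gauss_binom_eq[OF q k] by (simp add: burge_product_inf_def M power_add)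
  qed
  also have "\<dots> = q ^ b\<^sup>2 / qfac q N * (1 / qfac q (N + 2 * b))"
    unfolding sum_distrib_left[symmetric] sum_gauss_binom_div_qfac[OF q] ..
  also have "\<dots> = q ^ b\<^sup>2 * burge_product_inf q M b"
  proof -
    have "qfac q (M + b) = qfac q (N + 2 * b)" "qfac q (M - b) = qfac q N"
      by (rule arg_cong[where f = "qfac q"]; simp add: M)+
    then show ?thesis using True by (simp add: burge_product_inf_def)
  qed
  finally show ?thesis ..
next
  case False
  then show ?thesis by (auto simp: burge_product_inf_def)
qed

text \<open>A Euclidean subtraction that keeps the first argument infinite, so it can be iterated;
  the differences \<open>M - i\<close> will be the variables n of the theorem.\<close>

lemma burge_sum_inf_chain:
  fixes q :: "'a::{real_normed_field,banach}"
  assumes q: "norm q < 1" and "1 \<le> \<beta>"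
  shows "burge_sum_inf q (\<alpha> + \<beta>) \<beta> M = (\<Sum>i\<le>M. q ^ i\<^sup>2 / qfac q (M - i) * burge_sum_inf q \<alpha> \<beta> i)"
proof -
  have z: "burge_product_inf q i (\<beta> * j) = 0" if "i < j" for i j
  proof -
    have "j \<le> \<beta> * j" using assms by (cases \<beta>) auto
    then have "\<not> \<beta> * j \<le> i" using that by linarith
    then show ?thesis by (simp add: burge_product_inf_def)
  qed
  have "burge_sum_inf q (\<alpha> + \<beta>) \<beta> M = (\<Sum>j\<le>M. bilateral_weight j * (q ^ (\<alpha> * \<beta> * j\<^sup>2) *
      (q ^ (\<beta> * j)\<^sup>2 * burge_product_inf q M (\<beta> * j))))"
    by (simp add: burge_sum_inf_def algebra_simps power_add power2_eq_square)
  also have "\<dots> = (\<Sum>j\<le>M. \<Sum>i\<le>M. q ^ i\<^sup>2 / qfac q (M - i) *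
      (bilateral_weight j * (q ^ (\<alpha> * \<beta> * j\<^sup>2) * burge_product_inf q i (\<beta> * j))))"
    unfolding burge_product_inf_chain[OF q] sum_distrib_left by (intro sum.cong refl) (simp add: mult_ac)
  also have "\<dots> = (\<Sum>i\<le>M. q ^ i\<^sup>2 / qfac q (M - i) *
      (\<Sum>j\<le>M. bilateral_weight j * (q ^ (\<alpha> * \<beta> * j\<^sup>2) * burge_product_inf q i (\<beta> * j))))"
    by (subst sum.swap) (simp add: sum_distrib_left)
  also have "\<dots> = (\<Sum>i\<le>M. q ^ i\<^sup>2 / qfac q (M - i) * burge_sum_inf q \<alpha> \<beta> i)"
    unfolding burge_sum_inf_def by (intro sum.cong refl arg_cong2[where f = "(*)"] sum.mono_neutral_right) (auto simp: z)
  finally show ?thesis .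
qed

lemma burge_sum_inf_1_1:
  fixes q :: "'a::{real_normed_field,banach}"
  assumes q: "norm q < 1"
  shows "burge_sum_inf q 1 1 M = 1 / qfac (q\<^sup>2) M"
proof (rule LIMSEQ_unique)
  have q2: "norm (q\<^sup>2) < 1"
    using q by (simp add: norm_power power_less_one_iff)
  show "(\<lambda>L. burge_sum q 1 1 L M) \<longlonglongrightarrow> 1 / qfac (q\<^sup>2) M"
    unfolding burge_sum_1_1[OF q] by (rule gauss_binom_add_tendsto[OF q2])
  have B: "(\<lambda>L. burge_product q L M j j) \<longlonglongrightarrow> burge_product_inf q M j" if "j \<le> M" for j
  proof -
    have "(\<lambda>L. gauss_binom q (L + M) (M - j) * gauss_binom q (L + M) (M + j)) \<longlonglongrightarrow> 1 / qfac q (M - j) * (1 / qfac q (M + j))"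
      by (intro tendsto_intros gauss_binom_add_tendsto[OF q])
    moreover have "\<forall>\<^sub>F L in sequentially. burge_product q L M j j = gauss_binom q (L + M) (M - j) * gauss_binom q (L + M) (M + j)"
      using eventually_ge_at_top[of j] by eventually_elim (use that in \<open>auto intro!: burge_product_eqI\<close>)
    ultimately show ?thesis using that by (subst tendsto_cong) (auto simp: burge_product_inf_def)
  qed
  have "burge_sum q 1 1 L M = (\<Sum>j\<le>M. bilateral_weight j * (q ^ j\<^sup>2 * burge_product q L M j j))" for L
    using burge_sum_eq_sum[of 1 L M 1 M q] by simp
  then show "(\<lambda>L. burge_sum q 1 1 L M) \<longlonglongrightarrow> burge_sum_inf q 1 1 M"
    by (auto simp: burge_sum_inf_def intro!: tendsto_intros B)
qed

lemma qfac_inverse_bounded: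
  fixes q :: "'a::{real_normed_field,banach}"
  assumes q: "norm q < 1"
  obtains C where "1 \<le> C" "\<And>n. norm (1 / qfac q n) \<le> C" "\<And>n. norm (qfac q n) \<le> C"
proof -
  have "Bseq (qfac q)"
    using qfac_tendsto[OF q] by (intro convergent_imp_Bseq) (auto simp: convergent_def)
  moreover have "(\<lambda>n. 1 / qfac q n) \<longlonglongrightarrow> 1 / qfac_inf q"
    using qfac_inf_nonzero[OF q] by (intro tendsto_intros qfac_tendsto[OF q])
  then have "Bseq (\<lambda>n. 1 / qfac q n)"
    by (intro convergent_imp_Bseq) (auto simp: convergent_def)
  ultimately obtain C1 C2 where "\<And>n. norm (qfac q n) \<le> C1" "\<And>n. norm (1 / qfac q n) \<le> C2"
    unfolding Bseq_def by blast
  then show ?thesis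
    by (intro that[of "max 1 (max C1 C2)"]) (auto simp: le_max_iff_disj)
qed

text \<open>Dominated convergence for triangular arrays, the form in which finite identities are
  carried to their limits.\<close>

lemma tannery_finite_sums:
  fixes a :: "nat \<Rightarrow> nat \<Rightarrow> 'a::{real_normed_field,banach}"
  assumes "\<And>k. (\<lambda>n. a k n) \<longlonglongrightarrow> b k" "\<And>k n. norm (a k n) \<le> M k" "summable M"
    and "\<And>k n. n < k \<Longrightarrow> a k n = 0"
    and "(\<lambda>n. \<Sum>k\<le>n. a k n) \<longlonglongrightarrow> s"
  shows "summable (\<lambda>k. norm (b k))" "b sums s"
proof -
  have "suminf (\<lambda>k. a k n) = (\<Sum>k\<le>n. a k n)" for n
    using assms(4) by (intro suminf_finite) auto
  moreover have "summable (\<lambda>n. norm (b n)) \<and> ((\<lambda>n. suminf (\<lambda>k. a k n)) \<longlonglongrightarrow> suminf b)"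
    using tannerys_theorem[of a b sequentially M] assms(1,2,3)
    by (simp add: case_prod_unfold)
  ultimately show "summable (\<lambda>k. norm (b k))" "b sums s"
    using assms(5) LIMSEQ_unique by (auto simp: sums_iff summable_norm_cancel)
qed

text \<open>The limit N \<rightarrow> \<infinity> of \<open>sum_gauss_binom_div_qfac\<close>.
  Dominated convergence applies because k (k + c) \<ge> k and the remaining factors are
  bounded.\<close>

lemma durfee_rectangle_sums:
  fixes q :: "'a::{real_normed_field,banach}"
  assumes q: "norm q < 1"
  shows "summable (\<lambda>k. norm (q ^ (k * (k + c)) / (qfac q k * qfac q (k + c))))" (is ?A)
    "(\<lambda>k. q ^ (k * (k + c)) / (qfac q k * qfac q (k + c))) sums (1 / qfac_inf q)" (is ?B)
proof -
  obtain C where C: "1 \<le> C" "\<And>n. norm (1 / qfac q n) \<le> C" "\<And>n. norm (qfac q n) \<le> C"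
    using qfac_inverse_bounded[OF q] by blast
  let ?a = "\<lambda>k N. q ^ (k * (k + c)) * gauss_binom q N k / qfac q (k + c)"
  have "(\<lambda>N. ?a k N) \<longlonglongrightarrow> q ^ (k * (k + c)) * (1 / qfac q k) / qfac q (k + c)" for k
    using qfac_nonzero[OF q] by (intro tendsto_intros gauss_binom_tendsto[OF q])
  then have 1: "(\<lambda>N. ?a k N) \<longlonglongrightarrow> q ^ (k * (k + c)) / (qfac q k * qfac q (k + c))" for k
    by simp
  have 2: "norm (?a k N) \<le> C ^ 4 * norm q ^ k" for k N
  proof (cases "k \<le> N")
    case True
    have "?a k N = q ^ (k * (k + c)) * (qfac q N * (1 / qfac q k) * (1 / qfac q (N - k)) * (1 / qfac q (k + c)))"
      by (simp add: gauss_binom_eq[OF q True])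
    then have "norm (?a k N) = norm q ^ (k * (k + c)) *
      (norm (qfac q N) * norm (1 / qfac q k) * norm (1 / qfac q (N - k)) * norm (1 / qfac q (k + c)))"
      by (simp only: norm_mult norm_power)
    also have "\<dots> \<le> norm q ^ k * (C * C * C * C)"
    proof (intro mult_mono C)
      have "k \<le> k * (k + c)" by (cases k) auto
      then show "norm q ^ (k * (k + c)) \<le> norm q ^ k"
        using q by (intro power_decreasing) auto
    qed (use C(1) in auto)
    finally show ?thesis by (simp add: eval_nat_numeral mult_ac)
  qed (use C(1) in simp)
  have 3: "summable (\<lambda>k. C ^ 4 * norm q ^ k)"
    using q by (intro summable_mult summable_geometric) auto
  have 4: "(\<lambda>N. \<Sum>k\<le>N. ?a k N) \<longlonglongrightarrow> 1 / qfac_inf q"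
    unfolding sum_gauss_binom_div_qfac[OF q]
    using qfac_inf_nonzero[OF q] by (intro tendsto_intros qfac_add_tendsto[OF q])
  show ?A ?B
    using tannery_finite_sums[OF 1 2 3 _ 4] by auto
qed

text \<open>Gauss's product for the sum of (-1)^j q^(j^2) over all integers, obtained from
  \<open>burge_sum_inf_1_1\<close> as M \<rightarrow> \<infinity>: there each term acquires the
  factor 1/(q)_\<infinity>^2.\<close>

lemma theta_sums:
  fixes q :: "'a::{real_normed_field,banach}"
  assumes q: "norm q < 1"
  shows "summable (\<lambda>j. norm (bilateral_weight j * q ^ j\<^sup>2))" (is ?A)
    "(\<lambda>j. bilateral_weight j * q ^ j\<^sup>2) sums ((qfac_inf q)\<^sup>2 / qfac_inf (q\<^sup>2))" (is ?B)
proof -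
  obtain C where C: "1 \<le> C" "\<And>n. norm (1 / qfac q n) \<le> C" "\<And>n. norm (qfac q n) \<le> C"
    using qfac_inverse_bounded[OF q] by blast
  have q2: "norm (q\<^sup>2) < 1"
    using q by (simp add: norm_power power_less_one_iff)
  let ?a = "\<lambda>j M. bilateral_weight j * (q ^ j\<^sup>2 * burge_product_inf q M j)"
  have "(\<lambda>M. burge_product_inf q M j) \<longlonglongrightarrow> 1 / (qfac_inf q * qfac_inf q)" for j
  proof -
    have "(\<lambda>M. 1 / (qfac q (M - j) * qfac q (M + j))) \<longlonglongrightarrow> 1 / (qfac_inf q * qfac_inf q)"
      using qfac_inf_nonzero[OF q]
      by (intro tendsto_intros qfac_add_tendsto[OF q] qfac_diff_tendsto[OF q]) auto
    moreover have "\<forall>\<^sub>F M in sequentially. burge_product_inf q M j = 1 / (qfac q (M - j) * qfac q (M + j))"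
      using eventually_ge_at_top[of j] by eventually_elim (simp add: burge_product_inf_def)
    ultimately show ?thesis by (subst tendsto_cong)
  qed
  then have 1: "(\<lambda>M. ?a j M) \<longlonglongrightarrow> bilateral_weight j * (q ^ j\<^sup>2 * (1 / (qfac_inf q * qfac_inf q)))" for j
    by (intro tendsto_intros)
  have w: "norm (bilateral_weight j :: 'a) \<le> 2" for j
    by (simp add: bilateral_weight_def norm_mult norm_power)
  have 2: "norm (?a j M) \<le> 2 * C ^ 2 * norm q ^ j" for j M
  proof -
    have "norm (?a j M) = norm (bilateral_weight j :: 'a) * (norm q ^ j\<^sup>2 * norm (burge_product_inf q M j))"
      by (simp add: norm_mult norm_power)
    also have "\<dots> \<le> 2 * (norm q ^ j * C ^ 2)"
    proof (intro mult_mono w)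
      have "j \<le> j\<^sup>2" by (cases j) (auto simp: power2_eq_square)
      then show "norm q ^ j\<^sup>2 \<le> norm q ^ j"
        using q by (intro power_decreasing) auto
      have "norm (1 / qfac q (M - j)) * norm (1 / qfac q (M + j)) \<le> C * C"
        using C(1) by (intro mult_mono C) auto
      then show "norm (burge_product_inf q M j) \<le> C ^ 2"
        using C(1) by (auto simp: burge_product_inf_def norm_divide norm_mult power2_eq_square)
    qed (use C(1) in auto)
    finally show ?thesis by (simp add: mult_ac)
  qed
  have 3: "summable (\<lambda>j. 2 * C ^ 2 * norm q ^ j)"
    using q by (intro summable_mult summable_geometric) auto
  have "(\<Sum>j\<le>M. ?a j M) = 1 / qfac (q\<^sup>2) M" for M
    using burge_sum_inf_1_1[OF q, of M] by (simp add: burge_sum_inf_def)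
  then have 4: "(\<lambda>M. \<Sum>j\<le>M. ?a j M) \<longlonglongrightarrow> 1 / qfac_inf (q\<^sup>2)"
    using qfac_inf_nonzero[OF q2] by (auto intro!: tendsto_intros qfac_tendsto[OF q2])
  have nz: "qfac_inf q \<noteq> 0" by (rule qfac_inf_nonzero[OF q])
  have z: "?a j M = 0" if "M < j" for j M
    using that by (simp add: burge_product_inf_def)
  note T = tannery_finite_sums[OF 1 2 3 z 4]
  have "norm (bilateral_weight j * q ^ j\<^sup>2) = norm (bilateral_weight j * (q ^ j\<^sup>2 * (1 / (qfac_inf q * qfac_inf q)))) * norm (qfac_inf q * qfac_inf q)" for j
    unfolding norm_mult[symmetric] using nz by simp
  then show ?A
    using summable_mult2[OF T(1), of "norm (qfac_inf q * qfac_inf q)"] by simp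
  show ?B
    using sums_mult2[OF T(2), of "qfac_inf q * qfac_inf q"] nz by (simp add: power2_eq_square)
qed

text \<open>Summing the double series over \<open>i\<close> first, a Durfee rectangle sum gives
  q^((\<beta> j)^2)/(q)_\<infinity>; this completes the exponent to (\<alpha> + \<beta>) \<beta> j^2
  and leaves a theta series in base q^((\<alpha> + \<beta>) \<beta>). Summing over \<open>j\<close>
  first gives the left side. The double series is dominated by 2 C^2 |q|^(i+j).\<close>

lemma has_sum_burge_sum_inf:
  fixes q :: "'a::{real_normed_field,banach}"
  assumes q: "norm q < 1" and ab: "1 \<le> \<alpha>" "1 \<le> \<beta>"
  shows "((\<lambda>i. q ^ i\<^sup>2 * burge_sum_inf q \<alpha> \<beta> i) has_sum
     (qfac_inf (q ^ ((\<alpha> + \<beta>) * \<beta>)))\<^sup>2 / qfac_inf (q ^ (2 * ((\<alpha> + \<beta>) * \<beta>))) / qfac_inf q) UNIV"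
    (is "(_ has_sum ?S) _")
proof -
  obtain C where C: "1 \<le> C" "\<And>n. norm (1 / qfac q n) \<le> C" "\<And>n. norm (qfac q n) \<le> C"
    using qfac_inverse_bounded[OF q] by blast
  define h where "h = (\<lambda>(j, i). bilateral_weight j * (q ^ (\<alpha> * \<beta> * j\<^sup>2) * (q ^ i\<^sup>2 * burge_product_inf q i (\<beta> * j))))"
  have sq: "x \<le> x\<^sup>2" for x :: nat by (cases x) (auto simp: power2_eq_square)
  have w: "norm (bilateral_weight j :: 'a) \<le> 2" for j
    by (simp add: bilateral_weight_def norm_mult norm_power)
  have inner: "((\<lambda>i. q ^ i\<^sup>2 * burge_product_inf q i b) has_sum (q ^ b\<^sup>2 / qfac_inf q)) UNIV" for b
  proof -
    let ?d = "\<lambda>k. q ^ (k * (k + 2 * b)) / (qfac q k * qfac q (k + 2 * b))"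
    have "(?d has_sum (1 / qfac_inf q)) UNIV"
      using durfee_rectangle_sums[OF q, of "2 * b"] by (rule norm_summable_imp_has_sum)
    then have "((\<lambda>k. q ^ b\<^sup>2 * ?d k) has_sum (q ^ b\<^sup>2 * (1 / qfac_inf q))) UNIV"
      by (rule has_sum_cmult_right)
    moreover have "q ^ b\<^sup>2 * ?d k = q ^ (k + b)\<^sup>2 * burge_product_inf q (k + b) b" for k
    proof -
      have "(k + b)\<^sup>2 = b\<^sup>2 + k * (k + 2 * b)"
        by (simp add: power2_eq_square algebra_simps)
      moreover have "qfac q (k + b + b) = qfac q (k + 2 * b)" by (rule arg_cong[where f = "qfac q"]) simp
      ultimately show ?thesis by (simp add: burge_product_inf_def power_add)
    qed
    ultimately have "((\<lambda>k. q ^ (k + b)\<^sup>2 * burge_product_inf q (k + b) b) has_sum (q ^ b\<^sup>2 * (1 / qfac_inf q))) UNIV" by simp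
    then have "((\<lambda>i. q ^ i\<^sup>2 * burge_product_inf q i b) has_sum (q ^ b\<^sup>2 * (1 / qfac_inf q))) ((\<lambda>k. k + b) ` UNIV)"
      by (subst has_sum_reindex) (auto simp: o_def inj_on_def)
    also have "(\<lambda>k. k + b) ` UNIV = {b..}"
      by (auto simp: image_iff) (metis le_add_diff_inverse2)
    also have "((\<lambda>i. q ^ i\<^sup>2 * burge_product_inf q i b) has_sum (q ^ b\<^sup>2 * (1 / qfac_inf q))) {b..} \<longleftrightarrow>
        ((\<lambda>i. q ^ i\<^sup>2 * burge_product_inf q i b) has_sum (q ^ b\<^sup>2 * (1 / qfac_inf q))) UNIV"
      by (rule has_sum_cong_neutral) (auto simp: burge_product_inf_def)
    finally show ?thesis by simp
  qed
  have summable: "h summable_on UNIV \<times> UNIV"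
  proof -
    have g: "(\<lambda>j. norm q ^ j) summable_on UNIV"
      using q by (intro norm_summable_imp_summable_on) (simp add: summable_geometric)
    have s1: "((\<lambda>i. (2 * C ^ 2 * norm q ^ j) * norm q ^ i) has_sum (2 * C ^ 2 * norm q ^ j) * infsum (\<lambda>i. norm q ^ i) UNIV) UNIV" for j
      using g by (intro has_sum_cmult_right has_sum_infsum)
    have "(\<lambda>(j, i). (2 * C ^ 2 * norm q ^ j) * norm q ^ i) summable_on UNIV \<times> UNIV"
      using s1 C(1) by (intro summable_on_SigmaI) (auto intro!: summable_on_cmult_left summable_on_cmult_right g)
    then have G: "(\<lambda>x. norm (case x of (j, i) \<Rightarrow> (2 * C ^ 2 * norm q ^ j) * norm q ^ i)) summable_on UNIV \<times> UNIV"
      by (rule summable_on_iff_abs_summable_on_real[THEN iffD1])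
    have le: "norm (h x) \<le> norm (case x of (j, i) \<Rightarrow> (2 * C ^ 2 * norm q ^ j) * norm q ^ i)" for x
    proof -
    obtain j i where x: "x = (j, i)" by (cases x)
    have "norm (h x) = norm (bilateral_weight j :: 'a) * (norm q ^ (\<alpha> * \<beta> * j\<^sup>2) * (norm q ^ i\<^sup>2 * norm (burge_product_inf q i (\<beta> * j))))"
      by (simp add: h_def x norm_mult norm_power)
    also have "\<dots> \<le> 2 * (norm q ^ j * (norm q ^ i * C ^ 2))"
    proof (intro mult_mono w)
      have "1 * 1 * j \<le> \<alpha> * \<beta> * j\<^sup>2"
        using ab sq by (intro mult_mono) auto
      then show "norm q ^ (\<alpha> * \<beta> * j\<^sup>2) \<le> norm q ^ j"
        using q by (intro power_decreasing) auto
      show "norm q ^ i\<^sup>2 \<le> norm q ^ i"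
        using q sq by (intro power_decreasing) auto
      have "norm (1 / qfac q (i - \<beta> * j)) * norm (1 / qfac q (i + \<beta> * j)) \<le> C * C"
        using C(1) by (intro mult_mono C) auto
      then show "norm (burge_product_inf q i (\<beta> * j)) \<le> C ^ 2"
        using C(1) by (auto simp: burge_product_inf_def norm_divide norm_mult power2_eq_square)
    qed (use C(1) in auto)
    also have "\<dots> = norm (case x of (j, i) \<Rightarrow> (2 * C ^ 2 * norm q ^ j) * norm q ^ i)"
      using C(1) by (simp add: x abs_mult mult_ac)
    finally show ?thesis .
    qed
    show ?thesis
      by (rule abs_summable_summable, rule Infinite_Sum.abs_summable_on_comparison_test[OF G le])
  qed
  have qN: "norm (q ^ ((\<alpha> + \<beta>) * \<beta>)) < 1"
    using q ab by (simp add: norm_power power_less_one_iff)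
  have "((\<lambda>j. bilateral_weight j * (q ^ ((\<alpha> + \<beta>) * \<beta>)) ^ j\<^sup>2 / qfac_inf q) has_sum ?S) UNIV"
    using has_sum_cmult_left[OF norm_summable_imp_has_sum[OF theta_sums[OF qN]], of "1 / qfac_inf q"]
    by (simp add: power_mult[symmetric] mult_ac)
  moreover have "((\<lambda>i. h (j, i)) has_sum (bilateral_weight j * (q ^ ((\<alpha> + \<beta>) * \<beta>)) ^ j\<^sup>2 / qfac_inf q)) UNIV" for j
  proof -
    have "bilateral_weight j * (q ^ ((\<alpha> + \<beta>) * \<beta>)) ^ j\<^sup>2 / qfac_inf q =
        bilateral_weight j * (q ^ (\<alpha> * \<beta> * j\<^sup>2) * (q ^ (\<beta> * j)\<^sup>2 / qfac_inf q))"
      by (simp add: power_mult[symmetric] power_add[symmetric] algebra_simps power2_eq_square)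
    then show ?thesis unfolding h_def prod.case
      by (simp only:) (intro has_sum_cmult_right inner)
  qed
  ultimately have "(h has_sum ?S) (UNIV \<times> UNIV)"
    by (intro has_sum_SigmaI[OF _ _ summable]) auto
  moreover have "((\<lambda>x. h (prod.swap x)) has_sum ?S) (UNIV \<times> UNIV) \<longleftrightarrow> (h has_sum ?S) (UNIV \<times> UNIV)"
    by (rule has_sum_reindex_bij_betw) (simp add: bij_swap)
  ultimately have "((\<lambda>(i, j). h (j, i)) has_sum ?S) (UNIV \<times> UNIV)"
    by (simp add: prod.swap_def case_prod_unfold)
  moreover have "((\<lambda>j. h (j, i)) has_sum q ^ i\<^sup>2 * burge_sum_inf q \<alpha> \<beta> i) UNIV" for i
  proof -
    have "h (j, i) = 0" if "i < j" for j
    proof -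
      have "j \<le> \<beta> * j" using ab by (cases \<beta>) auto
      then have "\<not> \<beta> * j \<le> i" using that by linarith
      then show ?thesis by (simp add: h_def burge_product_inf_def)
    qed
    moreover have "((\<lambda>j. h (j, i)) has_sum (\<Sum>j\<le>i. h (j, i))) {..i}"
      by (rule has_sum_finite) simp
    moreover have "(\<Sum>j\<le>i. h (j, i)) = q ^ i\<^sup>2 * burge_sum_inf q \<alpha> \<beta> i"
      by (simp add: h_def burge_sum_inf_def sum_distrib_left mult_ac)
    ultimately show ?thesis
      by (intro has_sum_cong_neutral[THEN iffD1, of UNIV "{..i}" "\<lambda>j. h (j, i)"]) auto
  qed
  ultimately show ?thesis
    using has_sum_SigmaD[where f = "\<lambda>(i, j). h (j, i)" and A = UNIV and B = "\<lambda>_. UNIV"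
        and g = "\<lambda>i. q ^ i\<^sup>2 * burge_sum_inf q \<alpha> \<beta> i" and S = "?S"]
    by simp
qed

section \<open>The Burge transform along a continued fraction\<close>

lemma norm_gauss_binom_le:
  fixes q :: "'a::real_normed_field"
  shows "norm (gauss_binom q n k) \<le> gauss_binom (norm q) n k"
proof (induction q n k rule: gauss_binom.induct)
  case (3 q n k)
  have "norm (gauss_binom q (Suc n) (Suc k)) \<le> norm (gauss_binom q n k) + norm q ^ Suc k * norm (gauss_binom q n (Suc k))"
    by (simp add: norm_triangle_ineq[THEN order_trans] norm_mult norm_power)
  also have "\<dots> \<le> gauss_binom (norm q) n k + norm q ^ Suc k * gauss_binom (norm q) n (Suc k)"
    using 3 by (intro add_mono mult_left_mono) auto
  finally show ?case by simp
qed auto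

lemma norm_inverse_qfac_le:
  fixes q :: "'a::real_normed_field"
  assumes q: "norm q < 1"
  shows "norm (1 / qfac q n) \<le> 1 / qfac (norm q) n" "0 < qfac (norm q) n"
proof -
  have pos: "0 < 1 - norm q ^ Suc i" for i
    using q power_less_one_iff[of "norm q" "Suc i"] by simp
  then show *: "0 < qfac (norm q) n"
    unfolding qfac_def by (intro prod_pos) auto
  have "1 - norm q ^ Suc i \<le> norm (1 - q ^ Suc i)" for i
    using norm_triangle_ineq2[of 1 "q ^ Suc i"] by (simp add: norm_power norm_mult)
  then have "qfac (norm q) n \<le> norm (qfac q n)"
    unfolding qfac_def prod_norm[symmetric] using pos by (intro prod_mono) (auto simp: less_imp_le)
  then show "norm (1 / qfac q n) \<le> 1 / qfac (norm q) n"
    using * by (simp add: norm_divide frac_le)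
qed

text \<open>Numerator and denominator of the continued fraction; the empty one is \<open>1/0\<close>.\<close>

fun cf_pair :: "nat list \<Rightarrow> nat \<times> nat" where
  "cf_pair [] = (1, 0)"
| "cf_pair (c # cs) = (c * fst (cf_pair cs) + snd (cf_pair cs), fst (cf_pair cs))"

definition cf_ok :: "nat list \<Rightarrow> bool" where
  "cf_ok cs \<longleftrightarrow> cs \<noteq> [] \<and> (\<forall>c\<in>set cs. 1 \<le> c) \<and> (cs = [1] \<or> 2 \<le> last cs)"

text \<open>One subtraction in the Euclidean algorithm. When the leading quotient is used up,
  dropping it also inverts the fraction, that is, exchanges the pair.\<close>

definition cf_step :: "nat list \<Rightarrow> nat list" where
  "cf_step cs = (if hd cs = 1 then tl cs else (hd cs - 1) # tl cs)"

section \<open>Euclidean subtraction on lists of partial quotients\<close>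

lemma cf_pair_pos:
  assumes "\<forall>c\<in>set cs. 1 \<le> c"
  shows "1 \<le> fst (cf_pair cs)" "cs \<noteq> [] \<Longrightarrow> 1 \<le> snd (cf_pair cs)"
proof -
  have 1: "1 \<le> fst (cf_pair cs)" if "\<forall>c\<in>set cs. 1 \<le> c" for cs
    using that
  proof (induction cs)
    case (Cons c cs)
    then have "0 < c * fst (cf_pair cs)" by auto
    then show ?case unfolding cf_pair.simps fst_conv by linarith
  qed simp
  show "1 \<le> fst (cf_pair cs)" using 1 assms .
  show "1 \<le> snd (cf_pair cs)" if "cs \<noteq> []"
    using that assms 1[of "tl cs"] by (cases cs) auto
qed

lemma coprime_cf_pair: "coprime (fst (cf_pair cs)) (snd (cf_pair cs))"
proof (induction cs)
  case (Cons c cs)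
  then show ?case
    using gcd_add_mult[of "fst (cf_pair cs)" c "snd (cf_pair cs)"]
    by (simp add: coprime_iff_gcd_eq_1 gcd.commute)
qed simp

lemma cfval_eq_cf_pair:
  assumes "cs \<noteq> []" "\<forall>c\<in>set cs. 1 \<le> c"
  shows "cfval cs = of_nat (fst (cf_pair cs)) / of_nat (snd (cf_pair cs))"
  using assms
proof (induction cs rule: cfval.induct)
  case (3 c d cs)
  have "1 \<le> fst (cf_pair (d # cs))" "1 \<le> snd (cf_pair (d # cs))"
    using 3 cf_pair_pos[of "d # cs"] by simp_all
  then have "fst (cf_pair (d # cs)) \<noteq> 0" "snd (cf_pair (d # cs)) \<noteq> 0"
    by linarith+
  then have "(of_nat (fst (cf_pair (d # cs))) :: rat) \<noteq> 0" "(of_nat (snd (cf_pair (d # cs))) :: rat) \<noteq> 0"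
    unfolding of_nat_eq_0_iff .
  moreover have e: "cfval (d # cs) = of_nat (fst (cf_pair (d # cs))) / of_nat (snd (cf_pair (d # cs)))"
    using 3 by (intro 3(1)) auto
  ultimately show ?case
    unfolding cfval.simps(3) cf_pair.simps(2)[of c "d # cs"] fst_conv snd_conv e
    by (simp add: field_simps del: cf_pair.simps)
qed auto

lemma cf_step_ok:
  assumes "cf_ok cs" "cs \<noteq> [1]"
  shows "cf_ok (cf_step cs)" "sum_list cs = Suc (sum_list (cf_step cs))"
proof -
  obtain c cs' where cs: "cs = c # cs'" using assms by (cases cs) (auto simp: cf_ok_def)
  show "cf_ok (cf_step cs)" "sum_list cs = Suc (sum_list (cf_step cs))"
    using assms by (auto simp: cf_ok_def cf_step_def cs split: if_splits)
qed

lemma cf_ok_sum_list: "cf_ok cs \<Longrightarrow> 1 \<le> sum_list cs" "cf_ok cs \<Longrightarrow> cs \<noteq> [1] \<Longrightarrow> 2 \<le> sum_list cs"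
proof -
  show 1: "1 \<le> sum_list cs" if "cf_ok cs" for cs
    using that by (cases cs) (auto simp: cf_ok_def)
  show "2 \<le> sum_list cs" if "cf_ok cs" "cs \<noteq> [1]"
    using cf_step_ok[OF that] 1[of "cf_step cs"] by simp
qed

lemma cf_step_funpow:
  assumes "cf_ok cs" "k < sum_list cs"
  shows "cf_ok ((cf_step ^^ k) cs) \<and> sum_list ((cf_step ^^ k) cs) = sum_list cs - k"
  using assms(2)
proof (induction k)
  case 0
  then show ?case using assms by simp
next
  case (Suc k)
  then have "cf_ok ((cf_step ^^ k) cs)" "sum_list ((cf_step ^^ k) cs) = sum_list cs - k" by auto
  moreover from this have "(cf_step ^^ k) cs \<noteq> [1]" using Suc.prems by auto
  ultimately show ?case using cf_step_ok[of "(cf_step ^^ k) cs"] by simp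
qed

lemma cf_step_funpow_last:
  assumes "cf_ok cs"
  shows "(cf_step ^^ (sum_list cs - 1)) cs = [1]"
proof (rule ccontr)
  assume *: "(cf_step ^^ (sum_list cs - 1)) cs \<noteq> [1]"
  have "1 \<le> sum_list cs" using cf_ok_sum_list[OF assms] by simp
  then have "cf_ok ((cf_step ^^ (sum_list cs - 1)) cs)"
    "sum_list ((cf_step ^^ (sum_list cs - 1)) cs) = 1"
    using cf_step_funpow[OF assms, of "sum_list cs - 1"] by auto
  with cf_ok_sum_list(2)[OF _ *] show False by simp
qed

lemma Tset_Cons: "Tset (c # cs) = insert c ((+) c ` Tset cs)"
proof -
  have "{j. 1 \<le> j \<and> j \<le> length (c # cs)} = insert 1 (Suc ` {j. 1 \<le> j \<and> j \<le> length cs})"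
    by (auto simp: image_iff) presburger
  moreover have "Tset xs = tpos xs ` {j. 1 \<le> j \<and> j \<le> length xs}" for xs
    by (auto simp: Tset_def)
  ultimately show ?thesis by (simp add: image_image tpos_def)
qed

lemma Tset_pos:
  assumes "\<forall>c\<in>set cs. 1 \<le> c" "t \<in> Tset cs"
  shows "1 \<le> t"
  using assms by (cases cs) (auto simp: Tset_Cons, simp add: Tset_def)

text \<open>The link between the matrix and the Euclidean algorithm: the exceptional rows are those
  at which a partial quotient is used up and the pair is exchanged.\<close>

lemma Suc_Tset_iff:
  assumes "cf_ok cs" "k < sum_list cs"
  shows "Suc k \<in> Tset cs \<longleftrightarrow> hd ((cf_step ^^ k) cs) = 1"
  using assms
proof (induction k arbitrary: cs)
  case 0
  then obtain c cs' where cs: "cs = c # cs'" "1 \<le> c" "\<forall>c\<in>set cs'. 1 \<le> c"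
    by (cases cs) (auto simp: cf_ok_def)
  have "Suc 0 \<in> (+) c ` Tset cs' \<Longrightarrow> False"
    using Tset_pos[OF cs(3)] cs(2) by fastforce
  then show ?case using cs by (auto simp: Tset_Cons)
next
  case (Suc k)
  have n1: "cs \<noteq> [1]" using Suc.prems by auto
  obtain c cs' where cs: "cs = c # cs'" "1 \<le> c" "\<forall>c\<in>set cs'. 1 \<le> c"
    using Suc.prems by (cases cs) (auto simp: cf_ok_def)
  have "Suc (Suc k) \<in> Tset cs \<longleftrightarrow> Suc k \<in> Tset (cf_step cs)"
  proof (cases "c = 1")
    case True
    then show ?thesis by (auto simp: cs(1) cf_step_def Tset_Cons image_iff)
  next
    case False
    then obtain c' where "c = Suc c'" "c' \<noteq> 0" using cs(2) by (cases c) auto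
    then show ?thesis by (auto simp: cs(1) cf_step_def Tset_Cons image_iff)
  qed
  also have "\<dots> \<longleftrightarrow> hd ((cf_step ^^ k) (cf_step cs)) = 1"
    using cf_step_ok[OF Suc.prems(1) n1] Suc.prems(2) by (intro Suc.IH) auto
  finally show ?case by (simp add: funpow_swap1)
qed

definition cf_burge_sum :: "'a::comm_ring_1 \<Rightarrow> nat list \<Rightarrow> nat \<Rightarrow> nat \<Rightarrow> 'a" where
  "cf_burge_sum q cs L M = burge_sum q (fst (cf_pair cs)) (snd (cf_pair cs)) L M"

text \<open>Here the second argument of \<open>cf_burge_sum\<close> tends to infinity. By
  \<open>burge_sum_swap\<close> this is the limit in the first argument for the exchanged pair,
  hence the reversed order of \<open>fst\<close> and \<open>snd\<close>.\<close>

definition cf_burge_sum_inf :: "'a::real_normed_field \<Rightarrow> nat list \<Rightarrow> nat \<Rightarrow> 'a" where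
  "cf_burge_sum_inf q cs L = burge_sum_inf q (snd (cf_pair cs)) (fst (cf_pair cs)) L"

text \<open>
  The summation index of the Burge transform in terms of the next variable \<open>v\<close>: when a partial quotient
  is used up (\<open>hd cs = 1\<close>), the roles of \<open>L\<close> and \<open>M\<close> are exchanged.
\<close>

definition burge_index :: "nat list \<Rightarrow> nat \<Rightarrow> nat \<Rightarrow> nat" where
  "burge_index cs L v = (if hd cs = 1 then v else L - v)"

text \<open>The index is chosen so that the remaining sum always has arguments \<open>v\<close> and
  \<open>L - v\<close>. If the leading quotient exceeds 1, this reverses the summation, i = L - v;
  if it is 1, the exchange of the pair produces the same form with i = v.\<close>

lemma cf_burge_sum_cf_burge_sum_inf_step:
  fixes q :: "'a::real_normed_field"
  assumes q: "norm q < 1" and cs: "cf_ok cs" "cs \<noteq> [1]"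
  shows "cf_burge_sum q cs L M = (\<Sum>v\<le>L. q ^ (burge_index cs L v)\<^sup>2 *
      gauss_binom q (2 * L + M - burge_index cs L v) (2 * L) * cf_burge_sum q (cf_step cs) v (L - v))" (is ?F)
    and "cf_burge_sum_inf q cs L = (\<Sum>v\<le>L. q ^ (burge_index cs L v)\<^sup>2 * cf_burge_sum q (cf_step cs) v (L - v)) / qfac q (2 * L)" (is ?I)
proof -
  obtain c cs' where c: "cs = c # cs'" "1 \<le> c" "\<forall>c\<in>set cs'. 1 \<le> c"
    using cs by (cases cs) (auto simp: cf_ok_def)
  define p r where "p = fst (cf_pair cs')" and "r = snd (cf_pair cs')"
  have pos: "1 \<le> p" using cf_pair_pos[OF c(3)] by (simp add: p_def)
  have "?F \<and> ?I"
  proof (cases "c = 1")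
    case True
    then have "cs' \<noteq> []" using cs c by auto
    then have r: "1 \<le> r" using cf_pair_pos[OF c(3)] by (simp add: r_def)
    have pq: "cf_pair cs = (r + p, p)" using True by (simp add: c p_def r_def)
    have G: "cf_burge_sum q (cf_step cs) v (L - v) = burge_sum q r p (L - v) v" for v
      using True by (simp add: cf_burge_sum_def cf_step_def c p_def r_def burge_sum_swap[OF q, of _ _ v])
    have b: "burge_index cs L v = v" for v using True by (simp add: burge_index_def c)
    show ?thesis
      unfolding G b unfolding cf_burge_sum_def cf_burge_sum_inf_def pq fst_conv snd_conv
      using burge_sum_burge[OF q r, of p L M] burge_sum_inf_burge[OF q, of p r L] by simp
  next
    case False
    define a where "a = (c - 1) * p + r"
    have "0 < (c - 1) * p" using False c(2) pos by auto
    then have a: "1 \<le> a" unfolding a_def by linarith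
    have pq: "cf_pair cs = (a + p, p)"
      using c(2) by (cases c) (auto simp: c(1) a_def p_def r_def algebra_simps)
    have G: "cf_burge_sum q (cf_step cs) v (L - v) = burge_sum q a p v (L - v)" for v
      using False by (simp add: cf_burge_sum_def cf_step_def c(1) a_def p_def r_def)
    have b: "burge_index cs L v = L - v" for v using False by (simp add: burge_index_def c)
    have rev: "(\<Sum>i\<le>L. f i) = (\<Sum>v\<le>L. f (L - v))" for f :: "nat \<Rightarrow> 'a"
      by (rule sum.reindex_bij_witness[of _ "\<lambda>v. L - v" "\<lambda>v. L - v"]) auto
    have "(\<Sum>i\<le>L. q ^ i\<^sup>2 * gauss_binom q (2 * L + M - i) (2 * L) * burge_sum q a p (L - i) i) =
        (\<Sum>v\<le>L. q ^ (L - v)\<^sup>2 * gauss_binom q (2 * L + M - (L - v)) (2 * L) * burge_sum q a p v (L - v))"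
      by (subst rev) (intro sum.cong refl, simp)
    moreover have "(\<Sum>i\<le>L. q ^ i\<^sup>2 * burge_sum q a p (L - i) i) = (\<Sum>v\<le>L. q ^ (L - v)\<^sup>2 * burge_sum q a p v (L - v))"
      by (subst rev) (intro sum.cong refl, simp)
    ultimately show ?thesis
      unfolding G b unfolding cf_burge_sum_def cf_burge_sum_inf_def pq fst_conv snd_conv
      using burge_sum_burge[OF q a, of p L M] burge_sum_inf_burge[OF q, of p a L] by simp
  qed
  then show ?F ?I by auto
qed

lemma cf_burge_sum_singleton:
  fixes q :: "'a::real_normed_field"
  assumes "norm q < 1"
  shows "cf_burge_sum q [1] L M = gauss_binom (q\<^sup>2) (L + M) M"
  using burge_sum_1_1[OF assms] by (simp add: cf_burge_sum_def)

text \<open>The signs of the bilateral sum disappear on unfolding: each step has nonnegative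
  coefficients, and the last sum is a Gaussian binomial in base \<open>q\<^sup>2\<close>.\<close>

lemma norm_cf_burge_sum_le:
  fixes q :: "'a::real_normed_field"
  assumes q: "norm q < 1" and cs: "cf_ok cs"
  shows "norm (cf_burge_sum q cs L M) \<le> cf_burge_sum (norm q) cs L M"
  using cs
proof (induction "sum_list cs" arbitrary: cs L M rule: less_induct)
  case less
  have r: "norm (norm q) < 1" using q by simp
  show ?case
  proof (cases "cs = [1]")
    case True
    have "norm (gauss_binom (q\<^sup>2) (L + M) M) \<le> gauss_binom ((norm q)\<^sup>2) (L + M) M"
      using norm_gauss_binom_le[of "q\<^sup>2"] by (simp add: norm_power)
    then show ?thesis unfolding True cf_burge_sum_singleton[OF q] cf_burge_sum_singleton[OF r] .
  next
    case False
    note st = cf_step_ok[OF less.prems False]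
    show ?thesis
      unfolding cf_burge_sum_cf_burge_sum_inf_step(1)[OF q less.prems False] cf_burge_sum_cf_burge_sum_inf_step(1)[OF r less.prems False]
    proof (rule sum_norm_le)
      fix v
      have "norm (cf_burge_sum q (cf_step cs) v (L - v)) \<le> cf_burge_sum (norm q) (cf_step cs) v (L - v)"
        using less.hyps[of "cf_step cs"] st by simp
      then show "norm (q ^ (burge_index cs L v)\<^sup>2 * gauss_binom q (2 * L + M - burge_index cs L v) (2 * L) * cf_burge_sum q (cf_step cs) v (L - v))
        \<le> norm q ^ (burge_index cs L v)\<^sup>2 * gauss_binom (norm q) (2 * L + M - burge_index cs L v) (2 * L) * cf_burge_sum (norm q) (cf_step cs) v (L - v)"
        unfolding norm_mult norm_power
        by (intro mult_mono norm_gauss_binom_le order_refl mult_nonneg_nonneg order_trans[OF norm_ge_zero norm_gauss_binom_le]) auto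
    qed
  qed
qed

lemma norm_cf_burge_sum_inf_le:
  fixes q :: "'a::real_normed_field"
  assumes q: "norm q < 1" and cs: "cf_ok cs" "cs \<noteq> [1]"
  shows "norm (cf_burge_sum_inf q cs L) \<le> cf_burge_sum_inf (norm q) cs L"
proof -
  have r: "norm (norm q) < 1" using q by simp
  note G = norm_cf_burge_sum_le[OF q cf_step_ok(1)[OF cs]]
  have "norm (\<Sum>v\<le>L. q ^ (burge_index cs L v)\<^sup>2 * cf_burge_sum q (cf_step cs) v (L - v))
    \<le> (\<Sum>v\<le>L. norm q ^ (burge_index cs L v)\<^sup>2 * cf_burge_sum (norm q) (cf_step cs) v (L - v))"
    by (rule sum_norm_le) (auto simp: norm_mult norm_power intro!: mult_left_mono G)
  then have "norm (\<Sum>v\<le>L. q ^ (burge_index cs L v)\<^sup>2 * cf_burge_sum q (cf_step cs) v (L - v)) * norm (1 / qfac q (2 * L))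
    \<le> (\<Sum>v\<le>L. norm q ^ (burge_index cs L v)\<^sup>2 * cf_burge_sum (norm q) (cf_step cs) v (L - v)) * (1 / qfac (norm q) (2 * L))"
    by (rule mult_mono[OF _ norm_inverse_qfac_le(1)[OF q]])
       (auto intro!: sum_nonneg mult_nonneg_nonneg order_trans[OF norm_ge_zero G])
  then show ?thesis
    unfolding cf_burge_sum_cf_burge_sum_inf_step(2)[OF q cs] cf_burge_sum_cf_burge_sum_inf_step(2)[OF r cs] by (simp add: norm_divide)
qed

text \<open>The pair (1, 1) admits no further subtraction, so its majorant comes from the closed
  form. It is needed when the continued fraction has a single quotient.\<close>

lemma norm_burge_sum_inf_1_1_le:
  fixes q :: "'a::{real_normed_field,banach}"
  assumes q: "norm q < 1"
  shows "norm (burge_sum_inf q 1 1 L) \<le> burge_sum_inf (norm q) 1 1 L"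
proof -
  have r: "norm (norm q) < 1" using q by simp
  have q2: "norm (q\<^sup>2) < 1"
    using q by (simp add: norm_power power_less_one_iff)
  have "burge_sum_inf (norm q) 1 1 L = 1 / qfac ((norm q)\<^sup>2) L" using burge_sum_inf_1_1[OF r] .
  then show ?thesis
    using norm_inverse_qfac_le(1)[OF q2, of L] burge_sum_inf_1_1[OF q, of L] by (simp add: norm_power)
qed

lemma norm_burge_sum_inf_chain_le:
  fixes q :: "'a::{real_normed_field,banach}"
  assumes q: "norm q < 1" and "1 \<le> \<beta>" and base: "\<And>i. norm (burge_sum_inf q \<rho> \<beta> i) \<le> burge_sum_inf (norm q) \<rho> \<beta> i"
  shows "norm (burge_sum_inf q (k * \<beta> + \<rho>) \<beta> M) \<le> burge_sum_inf (norm q) (k * \<beta> + \<rho>) \<beta> M"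
proof (induction k arbitrary: M)
  case 0
  then show ?case using base by simp
next
  case (Suc k)
  have r: "norm (norm q) < 1" using q by simp
  have e: "Suc k * \<beta> + \<rho> = (k * \<beta> + \<rho>) + \<beta>" by simp
  show ?case
    unfolding e burge_sum_inf_chain[OF q \<open>1 \<le> \<beta>\<close>] burge_sum_inf_chain[OF r \<open>1 \<le> \<beta>\<close>]
  proof (rule sum_norm_le)
    fix i
    have "norm q ^ i\<^sup>2 * norm (1 / qfac q (M - i)) * norm (burge_sum_inf q (k * \<beta> + \<rho>) \<beta> i)
      \<le> norm q ^ i\<^sup>2 * (1 / qfac (norm q) (M - i)) * burge_sum_inf (norm q) (k * \<beta> + \<rho>) \<beta> i"
      using norm_inverse_qfac_le[OF q, of "M - i"] by (intro mult_mono Suc.IH) auto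
    then show "norm (q ^ i\<^sup>2 / qfac q (M - i) * burge_sum_inf q (k * \<beta> + \<rho>) \<beta> i)
      \<le> norm q ^ i\<^sup>2 / qfac (norm q) (M - i) * burge_sum_inf (norm q) (k * \<beta> + \<rho>) \<beta> i"
      by (simp add: norm_mult norm_divide norm_power)
  qed
qed

text \<open>Refines a known sum: \<open>J\<close> is the disjoint union of the fibres of
  \<open>p\<close>. The majorant is nonnegative with summable fibre sums, hence summable on
  \<open>J\<close>; comparison makes \<open>g\<close> summable, and its value is then found fibre by
  fibre.\<close>

lemma has_sum_fibres:
  fixes f :: "'i \<Rightarrow> 'a::banach" and fr :: "'i \<Rightarrow> real"
  assumes f: "(f has_sum s) I" and fr: "fr summable_on I"
    and p: "\<And>j. j \<in> J \<Longrightarrow> p j \<in> I"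
    and g: "\<And>i. i \<in> I \<Longrightarrow> (g has_sum f i) {j \<in> J. p j = i}"
    and gr: "\<And>i. i \<in> I \<Longrightarrow> (gr has_sum fr i) {j \<in> J. p j = i}"
    and le: "\<And>j. j \<in> J \<Longrightarrow> norm (g j) \<le> gr j"
  shows "(g has_sum s) J" "gr summable_on J"
proof -
  let ?S = "Sigma I (\<lambda>i. {j \<in> J. p j = i})"
  have bij: "bij_betw snd ?S J"
    using p by (auto simp: bij_betw_def inj_on_def image_iff)
  have nonneg: "0 \<le> gr j" if "j \<in> J" for j
    using le[OF that] norm_ge_zero order_trans by blast
  have 1: "(\<lambda>x. gr (snd x)) summable_on ?S"
    by (rule summable_on_SigmaI[OF _ fr]) (use gr nonneg in auto)
  then show "gr summable_on J"
    by (subst (asm) summable_on_reindex_bij_betw[OF bij])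
  have "(\<lambda>x. norm (gr (snd x))) summable_on ?S"
    using 1 by (rule summable_on_iff_abs_summable_on_real[THEN iffD1])
  moreover have "norm (g (snd x)) \<le> norm (gr (snd x))" if "x \<in> ?S" for x
    using le[of "snd x"] that by auto
  ultimately have "(\<lambda>x. norm (g (snd x))) summable_on ?S"
    by (rule Infinite_Sum.abs_summable_on_comparison_test)
  then have "(\<lambda>x. g (snd x)) summable_on ?S"
    by (rule abs_summable_summable)
  then have "((\<lambda>x. g (snd x)) has_sum s) ?S"
    using f g by (intro has_sum_SigmaI[where g = f]) auto
  then show "(g has_sum s) J"
    by (subst (asm) has_sum_reindex_bij_betw[OF bij])
qed

section \<open>Introducing the summation variables one at a time\<close>

lemma has_sum_range_finite_support:
  assumes "inj h" "finite F" "\<And>v. v \<notin> F \<Longrightarrow> g (h v) = 0"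
  shows "(g has_sum (\<Sum>v\<in>F. g (h v))) (range h)"
proof -
  have "((\<lambda>v. g (h v)) has_sum (\<Sum>v\<in>F. g (h v))) F"
    using assms(2) by (rule has_sum_finite)
  also have "?this \<longleftrightarrow> ((\<lambda>v. g (h v)) has_sum (\<Sum>v\<in>F. g (h v))) UNIV"
    using assms(3) by (intro has_sum_cong_neutral) auto
  finally show ?thesis
    using assms(1) by (simp add: has_sum_reindex o_def)
qed

text \<open>
  In \<open>m_state q ts k \<mu>\<close> the variables \<open>\<mu> 0, \<dots>, \<mu> k\<close> (the \<open>m\<^sub>j\<close> of the theorem, shifted to start at 0)
  are explicit and the sums over the later ones are still collected in one \<open>cf_burge_sum\<close>; in
  \<open>n_state\<close>, \<open>i\<close> is the part of \<open>N\<^sub>l + m\<close> that is not yet split into \<open>n\<close>'s.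
\<close>

definition step_index :: "nat list \<Rightarrow> (nat \<Rightarrow> nat) \<Rightarrow> nat \<Rightarrow> nat" where
  "step_index ts \<mu> l = burge_index ((cf_step ^^ l) ts) (\<mu> l) (\<mu> (Suc l))"

text \<open>The upper entry is 2L + M - i with L = \<open>\<mu> l\<close>, M =
  \<open>\<mu> (l - 1) - \<mu> l\<close> and i the step index. There is no binomial for
  \<open>l = 0\<close>, where M is infinite and 1/(q)_(2L) appears instead. The zero branch confines
  the sum to non-increasing \<mu>, where these differences are not truncated.\<close>

definition m_weight :: "'a::real_normed_field \<Rightarrow> nat list \<Rightarrow> nat \<Rightarrow> (nat \<Rightarrow> nat) \<Rightarrow> 'a" where
  "m_weight q ts k \<mu> = q ^ (\<mu> 0)\<^sup>2 / qfac q (2 * \<mu> 0)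
     * (\<Prod>l<k. if \<mu> (Suc l) \<le> \<mu> l then q ^ (step_index ts \<mu> l)\<^sup>2 else 0)
     * (\<Prod>l=1..<k. gauss_binom q (\<mu> (l - 1) + \<mu> l - step_index ts \<mu> l) (2 * \<mu> l))"

definition m_state :: "'a::real_normed_field \<Rightarrow> nat list \<Rightarrow> nat \<Rightarrow> (nat \<Rightarrow> nat) \<Rightarrow> 'a" where
  "m_state q ts k \<mu> = (if k = 0 then q ^ (\<mu> 0)\<^sup>2 * cf_burge_sum_inf q ts (\<mu> 0)
     else m_weight q ts k \<mu> * cf_burge_sum q ((cf_step ^^ k) ts) (\<mu> k) (\<mu> (k - 1) - \<mu> k))"

lemma m_weight_upd: "m_weight q ts k (\<mu>(Suc k := v)) = m_weight q ts k \<mu>"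
proof -
  have "step_index ts (\<mu>(Suc k := v)) l = step_index ts \<mu> l" if "l < k" for l
    using that by (simp add: step_index_def)
  then show ?thesis unfolding m_weight_def
    by (intro arg_cong2[where f = "(*)"] prod.cong) auto
qed

lemma m_weight_Suc:
  "m_weight q ts (Suc k) \<mu> = m_weight q ts k \<mu>
     * (if \<mu> (Suc k) \<le> \<mu> k then q ^ (step_index ts \<mu> k)\<^sup>2 else 0)
     * (if k = 0 then 1 else gauss_binom q (\<mu> (k - 1) + \<mu> k - step_index ts \<mu> k) (2 * \<mu> k))"
  by (cases k) (simp_all add: m_weight_def)

lemma m_weight_eq_0: "l < k \<Longrightarrow> \<mu> l < \<mu> (Suc l) \<Longrightarrow> m_weight q ts k \<mu> = 0"
  by (auto simp: m_weight_def intro!: bexI[of _ l])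

lemma m_state_Suc_eq_0: "\<mu> k < v \<Longrightarrow> m_state q ts (Suc k) (\<mu>(Suc k := v)) = 0"
  using m_weight_eq_0[of k "Suc k" "\<mu>(Suc k := v)" q ts] by (simp add: m_state_def)

lemma m_state_step:
  fixes q :: "'a::real_normed_field"
  assumes q: "norm q < 1" and ts: "cf_ok ts" and k: "Suc k < sum_list ts"
  shows "m_state q ts k \<mu> = (\<Sum>v\<le>\<mu> k. m_state q ts (Suc k) (\<mu>(Suc k := v)))"
proof -
  let ?r = "(cf_step ^^ k) ts"
  have r: "cf_ok ?r" "?r \<noteq> [1]"
    using cf_step_funpow[OF ts, of k] k by auto
  have st: "(cf_step ^^ Suc k) ts = cf_step ?r" by simp
  have nxt: "m_state q ts (Suc k) (\<mu>(Suc k := v)) = m_weight q ts k \<mu>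
      * q ^ (burge_index ?r (\<mu> k) v)\<^sup>2
      * (if k = 0 then 1 else gauss_binom q (\<mu> (k - 1) + \<mu> k - burge_index ?r (\<mu> k) v) (2 * \<mu> k))
      * cf_burge_sum q (cf_step ?r) v (\<mu> k - v)" if "v \<le> \<mu> k" for v
    using that unfolding m_state_def m_weight_Suc m_weight_upd st
    by (simp add: step_index_def)
  show ?thesis
  proof (cases "k = 0")
    case True
    have "m_weight q ts 0 \<mu> = q ^ (\<mu> 0)\<^sup>2 / qfac q (2 * \<mu> 0)" by (simp add: m_weight_def)
    then have "m_state q ts 0 \<mu> = m_weight q ts 0 \<mu> *
        (\<Sum>v\<le>\<mu> 0. q ^ (burge_index ts (\<mu> 0) v)\<^sup>2 * cf_burge_sum q (cf_step ts) v (\<mu> 0 - v))"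
      using True cf_burge_sum_cf_burge_sum_inf_step(2)[OF q r, of "\<mu> 0"] by (simp add: m_state_def)
    also have "\<dots> = (\<Sum>v\<le>\<mu> 0. m_state q ts (Suc 0) (\<mu>(Suc 0 := v)))"
      unfolding sum_distrib_left
      using nxt True by (intro sum.cong refl) (simp add: mult_ac)
    finally show ?thesis using True by simp
  next
    case False
    show ?thesis
    proof (cases "\<mu> k \<le> \<mu> (k - 1)")
      case True
      then have e: "2 * \<mu> k + (\<mu> (k - 1) - \<mu> k) - x = \<mu> (k - 1) + \<mu> k - x" for x by simp
      have "m_state q ts k \<mu> = m_weight q ts k \<mu> * cf_burge_sum q ?r (\<mu> k) (\<mu> (k - 1) - \<mu> k)"
        using False by (simp add: m_state_def)
      also have "\<dots> = (\<Sum>v\<le>\<mu> k. m_state q ts (Suc k) (\<mu>(Suc k := v)))"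
        unfolding cf_burge_sum_cf_burge_sum_inf_step(1)[OF q r] e sum_distrib_left
        using False by (intro sum.cong refl) (simp add: nxt mult_ac)
      finally show ?thesis .
    next
      case nle: False
      \<comment> \<open>Here \<open>\<mu> (k - 1) - \<mu> k\<close> is truncated and the Burge step
        does not match, but the weight makes both sides zero.\<close>
      then have "m_weight q ts k \<mu> = 0"
        using m_weight_eq_0[of "k - 1" k \<mu>] False by simp
      then show ?thesis using False by (simp add: nxt) (simp add: m_state_def)
    qed
  qed
qed

lemma norm_m_weight_le:
  fixes q :: "'a::real_normed_field"
  assumes q: "norm q < 1"
  shows "norm (m_weight q ts k \<mu>) \<le> m_weight (norm q) ts k \<mu>"
proof -
  have "norm q ^ (\<mu> 0)\<^sup>2 * norm (1 / qfac q (2 * \<mu> 0)) \<le> norm q ^ (\<mu> 0)\<^sup>2 * (1 / qfac (norm q) (2 * \<mu> 0))"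
    using norm_inverse_qfac_le[OF q] by (intro mult_left_mono) auto
  moreover have "(\<Prod>l<k. norm (if \<mu> (Suc l) \<le> \<mu> l then q ^ (step_index ts \<mu> l)\<^sup>2 else 0)) \<le>
      (\<Prod>l<k. if \<mu> (Suc l) \<le> \<mu> l then norm q ^ (step_index ts \<mu> l)\<^sup>2 else 0)"
    by (rule prod_mono) (auto simp: norm_power)
  moreover have "(\<Prod>l=1..<k. norm (gauss_binom q (\<mu> (l - 1) + \<mu> l - step_index ts \<mu> l) (2 * \<mu> l))) \<le>
      (\<Prod>l=1..<k. gauss_binom (norm q) (\<mu> (l - 1) + \<mu> l - step_index ts \<mu> l) (2 * \<mu> l))"
    by (rule prod_mono) (auto simp: norm_gauss_binom_le)
  ultimately have "norm q ^ (\<mu> 0)\<^sup>2 * norm (1 / qfac q (2 * \<mu> 0))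
      * (\<Prod>l<k. norm (if \<mu> (Suc l) \<le> \<mu> l then q ^ (step_index ts \<mu> l)\<^sup>2 else 0))
      * (\<Prod>l=1..<k. norm (gauss_binom q (\<mu> (l - 1) + \<mu> l - step_index ts \<mu> l) (2 * \<mu> l)))
    \<le> m_weight (norm q) ts k \<mu>"
    unfolding m_weight_def using norm_inverse_qfac_le(2)[OF q, of "2 * \<mu> 0"]
    by (intro mult_mono) (auto intro!: prod_nonneg mult_nonneg_nonneg divide_nonneg_pos)
  then show ?thesis
    by (simp add: m_weight_def norm_mult norm_divide norm_power prod_norm)
qed

lemma norm_m_state_le:
  fixes q :: "'a::real_normed_field"
  assumes q: "norm q < 1" and ts: "cf_ok ts" "ts \<noteq> [1]" and k: "k < sum_list ts"
  shows "norm (m_state q ts k \<mu>) \<le> m_state (norm q) ts k \<mu>"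
proof (cases "k = 0")
  case True
  then show ?thesis
    using norm_cf_burge_sum_inf_le[OF q ts] by (simp add: m_state_def norm_mult norm_power mult_left_mono)
next
  case False
  have "cf_ok ((cf_step ^^ k) ts)"
    using cf_step_funpow[OF ts(1) k] by simp
  with False show ?thesis
    unfolding m_state_def norm_mult
    by (auto simp: norm_mult intro!: mult_mono norm_m_weight_le[OF q] norm_cf_burge_sum_le[OF q]
        order_trans[OF norm_ge_zero norm_m_weight_le[OF q]])
qed

text \<open>The first variable stays fixed at \<open>i\<close>, because it is the value through
  which this part of the sum is attached to the variables n.\<close>

definition m_index :: "nat \<Rightarrow> nat \<Rightarrow> (nat \<Rightarrow> nat) set" where
  "m_index i k = {\<mu>. \<mu> 0 = i \<and> (\<forall>j. \<mu> j \<noteq> 0 \<longrightarrow> j \<le> k)}"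

lemma m_index_fibre:
  assumes "\<mu> \<in> m_index i k"
  shows "{\<mu>' \<in> m_index i (Suc k). \<mu>'(Suc k := 0) = \<mu>} = range (\<lambda>v. \<mu>(Suc k := v))"
proof (intro equalityI subsetI)
  fix \<mu>' assume "\<mu>' \<in> {\<mu>' \<in> m_index i (Suc k). \<mu>'(Suc k := 0) = \<mu>}"
  then have "\<mu>' = \<mu>(Suc k := \<mu>' (Suc k))" by auto
  then show "\<mu>' \<in> range (\<lambda>v. \<mu>(Suc k := v))" by blast
next
  fix \<mu>' assume "\<mu>' \<in> range (\<lambda>v. \<mu>(Suc k := v))"
  then obtain v where v: "\<mu>' = \<mu>(Suc k := v)" by blast
  have "\<mu> (Suc k) = 0" using assms by (auto simp: m_index_def)
  then have "\<mu>(Suc k := 0) = \<mu>" by (metis fun_upd_triv)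
  then show "\<mu>' \<in> {\<mu>' \<in> m_index i (Suc k). \<mu>'(Suc k := 0) = \<mu>}"
    using assms by (auto simp: v m_index_def le_Suc_eq)
qed

lemma m_state_has_sum:
  fixes q :: "'a::{real_normed_field,banach}"
  assumes q: "norm q < 1" and ts: "cf_ok ts" "ts \<noteq> [1]" and k: "k < sum_list ts"
  shows "(m_state q ts k has_sum (q ^ i\<^sup>2 * cf_burge_sum_inf q ts i)) (m_index i k) \<and>
    m_state (norm q) ts k summable_on m_index i k"
  using k
proof (induction k)
  case 0
  have "m_index i 0 = {(\<lambda>_. 0)(0 := i)}"
    unfolding m_index_def by (auto simp: fun_eq_iff split: if_splits)
  then show ?case
    by (auto simp: m_state_def intro!: has_sum_finiteI)
next
  case (Suc k)
  have r: "norm (norm q) < 1" using q by simp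
  have inj: "inj (\<lambda>v. \<mu>(Suc k := v))" for \<mu> :: "nat \<Rightarrow> nat"
    by (auto simp: inj_def dest: fun_upd_eqD)
  \<comment> \<open>Stated for any field, since the fibre sums are needed for \<open>q\<close> and
    for its real majorant.\<close>
  have fib: "(m_state x ts (Suc k) has_sum m_state x ts k \<mu>) {\<mu>' \<in> m_index i (Suc k). \<mu>'(Suc k := 0) = \<mu>}"
    if "\<mu> \<in> m_index i k" "norm x < 1" for \<mu> and x :: "'b::real_normed_field"
    unfolding m_index_fibre[OF that(1)] m_state_step[OF that(2) ts(1) Suc.prems]
    by (rule has_sum_range_finite_support[OF inj]) (auto intro: m_state_Suc_eq_0)
  note IH = Suc.IH[OF Suc_lessD[OF Suc.prems]]
  have p: "\<mu>(Suc k := 0) \<in> m_index i k" if "\<mu> \<in> m_index i (Suc k)" for \<mu>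
    using that unfolding m_index_def by (auto simp: le_Suc_eq)
  show ?case
    using has_sum_fibres[OF conjunct1[OF IH] conjunct2[OF IH] p fib[OF _ q] fib[OF _ r]
        norm_m_state_le[OF q ts Suc.prems]] by blast
qed

section \<open>Splitting off the variables n\<close>

definition n_weight :: "'a::real_normed_field \<Rightarrow> nat \<Rightarrow> (nat \<Rightarrow> nat) \<Rightarrow> nat \<Rightarrow> 'a" where
  "n_weight q k n i = q ^ (\<Sum>l=1..k. ((\<Sum>t=l..k. n t) + i)\<^sup>2) / (\<Prod>l=1..k. qfac q (n l))"

text \<open>Splitting i = (i - i') + i' and naming the first part n_(k+1) leaves all earlier N_l + i
  unchanged; only the new square i^2 and the factor 1/(q)_(i-i') are added.\<close>

lemma n_weight_Suc:
  assumes "i' \<le> i"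
  shows "n_weight q (Suc k) (n(Suc k := i - i')) i' = n_weight q k n i * (q ^ i\<^sup>2 / qfac q (i - i'))"
proof -
  let ?n = "n(Suc k := i - i')"
  have "(\<Sum>l=1..k. ((\<Sum>t=l..Suc k. ?n t) + i')\<^sup>2) = (\<Sum>l=1..k. ((\<Sum>t=l..k. n t) + i)\<^sup>2)"
  proof (rule sum.cong[OF refl])
    fix l assume "l \<in> {1..k}"
    then have "(\<Sum>t=l..Suc k. ?n t) = (\<Sum>t=l..k. ?n t) + (i - i')" by simp
    also have "(\<Sum>t=l..k. ?n t) = (\<Sum>t=l..k. n t)" by (rule sum.cong) auto
    finally show "((\<Sum>t=l..Suc k. ?n t) + i')\<^sup>2 = ((\<Sum>t=l..k. n t) + i)\<^sup>2"
      using assms by simp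
  qed
  moreover have "(\<Prod>l=1..k. qfac q (?n l)) = (\<Prod>l=1..k. qfac q (n l))"
    by (rule prod.cong) auto
  ultimately show ?thesis
    using assms by (simp add: n_weight_def power_add)
qed

lemma norm_n_weight_le:
  fixes q :: "'a::real_normed_field"
  assumes q: "norm q < 1"
  shows "norm (n_weight q k n i) \<le> n_weight (norm q) k n i"
proof -
  have "(\<Prod>l=1..k. norm (1 / qfac q (n l))) \<le> (\<Prod>l=1..k. 1 / qfac (norm q) (n l))"
    using norm_inverse_qfac_le[OF q] by (intro prod_mono) auto
  then have "norm q ^ s * (\<Prod>l=1..k. norm (1 / qfac q (n l))) \<le> norm q ^ s * (\<Prod>l=1..k. 1 / qfac (norm q) (n l))" for s
    by (rule mult_left_mono) simp
  then show ?thesis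
    by (simp add: n_weight_def norm_divide norm_power prod_norm[symmetric] prod_dividef)
qed

definition n_state :: "'a::real_normed_field \<Rightarrow> nat \<Rightarrow> nat \<Rightarrow> nat \<Rightarrow> nat \<Rightarrow> (nat \<Rightarrow> nat) \<times> nat \<Rightarrow> 'a" where
  "n_state q \<beta> \<rho> K k = (\<lambda>(n, i). n_weight q k n i * (q ^ i\<^sup>2 * burge_sum_inf q ((K - k) * \<beta> + \<rho>) \<beta> i))"

definition n_index :: "nat \<Rightarrow> (nat \<Rightarrow> nat) set" where
  "n_index k = {n. \<forall>t. n t \<noteq> 0 \<longrightarrow> t \<in> {1..k}}"

lemma n_index_fibre:
  assumes "n \<in> n_index k"
  shows "{x \<in> n_index (Suc k) \<times> UNIV. ((fst x)(Suc k := 0), fst x (Suc k) + snd x) = (n, i)}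
    = (\<lambda>i'. (n(Suc k := i - i'), i')) ` {..i}" (is "?A = ?B")
proof (intro equalityI subsetI)
  fix x assume x: "x \<in> ?A"
  obtain n' i' where xe: "x = (n', i')" by (cases x)
  have "n' = n(Suc k := n' (Suc k))" using x by (auto simp: xe)
  moreover have "n' (Suc k) = i - i'" "i' \<le> i" using x by (auto simp: xe)
  ultimately show "x \<in> ?B" by (auto simp: xe)
next
  fix x assume "x \<in> ?B"
  then obtain i' where x: "x = (n(Suc k := i - i'), i')" "i' \<le> i" by blast
  have "n (Suc k) = 0" using assms by (auto simp: n_index_def)
  then have "n(Suc k := 0) = n" by (metis fun_upd_triv)
  then show "x \<in> ?A"
    using assms by (auto simp: x n_index_def le_Suc_eq)
qed

text \<open>Starts from the single sum for \<alpha> = K \<beta> + \<rho> and applies the chain step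
  \<open>k\<close> times, lowering \<alpha> by \<beta> each time. The bound at \<rho> is left as a
  hypothesis, as its proof depends on whether a continued fraction remains.\<close>

lemma n_state_has_sum:
  fixes q :: "'a::{real_normed_field,banach}"
  assumes q: "norm q < 1" and pos: "1 \<le> \<rho>" "1 \<le> \<beta>" and k: "k \<le> K"
    and base: "\<And>i. norm (burge_sum_inf q \<rho> \<beta> i) \<le> burge_sum_inf (norm q) \<rho> \<beta> i"
  shows "(n_state q \<beta> \<rho> K k has_sum
       (qfac_inf (q ^ ((K * \<beta> + \<rho> + \<beta>) * \<beta>)))\<^sup>2 / qfac_inf (q ^ (2 * ((K * \<beta> + \<rho> + \<beta>) * \<beta>))) / qfac_inf q) (n_index k \<times> UNIV) \<and>
    n_state (norm q) \<beta> \<rho> K k summable_on (n_index k \<times> UNIV)"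
  using k
proof (induction k)
  case 0
  have I: "n_index 0 \<times> UNIV = range (Pair (\<lambda>_. 0))"
    by (auto simp: n_index_def)
  have st: "n_state x \<beta> \<rho> K 0 \<circ> Pair (\<lambda>_. 0) = (\<lambda>i. x ^ i\<^sup>2 * burge_sum_inf x (K * \<beta> + \<rho>) \<beta> i)"
    for x :: "'b::real_normed_field"
    by (auto simp: n_state_def n_weight_def)
  have \<alpha>: "1 \<le> K * \<beta> + \<rho>" using pos by simp
  have inj: "inj (Pair (\<lambda>_::nat. 0::nat) :: nat \<Rightarrow> _)" by (auto simp: inj_def)
  have r: "norm (norm q) < 1" using q by simp
  show ?case
    unfolding I has_sum_reindex[OF inj] summable_on_reindex[OF inj] st
    using has_sum_burge_sum_inf[OF q \<alpha> pos(2)] has_sum_burge_sum_inf[OF r \<alpha> pos(2)] by (auto simp: summable_on_def)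
next
  case (Suc k)
  have r: "norm (norm q) < 1" using q by simp
  let ?p = "\<lambda>x :: (nat \<Rightarrow> nat) \<times> nat. ((fst x)(Suc k := 0), fst x (Suc k) + snd x)"
  have fib: "(n_state x \<beta> \<rho> K (Suc k) has_sum n_state x \<beta> \<rho> K k z) {y \<in> n_index (Suc k) \<times> UNIV. ?p y = z}"
    if "z \<in> n_index k \<times> UNIV" "norm x < 1" for z and x :: "'b::{real_normed_field,banach}"
  proof -
    obtain n i where z: "z = (n, i)" by (cases z)
    have n: "n \<in> n_index k" using that by (simp add: z)
    have e: "(K - k) * \<beta> + \<rho> = ((K - Suc k) * \<beta> + \<rho>) + \<beta>"
      using Suc.prems by (simp add: Suc_diff_Suc[symmetric])
    have "n_state x \<beta> \<rho> K k z = (\<Sum>i'\<le>i. n_state x \<beta> \<rho> K (Suc k) (n(Suc k := i - i'), i'))"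
      unfolding n_state_def z prod.case e burge_sum_inf_chain[OF that(2) pos(2)] sum_distrib_left
      by (intro sum.cong refl) (simp add: n_weight_Suc mult_ac)
    also have "\<dots> = sum (n_state x \<beta> \<rho> K (Suc k)) ((\<lambda>i'. (n(Suc k := i - i'), i')) ` {..i})"
      by (subst sum.reindex) (auto simp: inj_on_def)
    finally show ?thesis
      unfolding z n_index_fibre[OF n] by (intro has_sum_finiteI) auto
  qed
  have le: "norm (n_state q \<beta> \<rho> K (Suc k) x) \<le> n_state (norm q) \<beta> \<rho> K (Suc k) x" for x
  proof (cases x)
    case (Pair n i)
    have w: "0 \<le> n_weight (norm q) (Suc k) n i"
      using norm_n_weight_le[OF q] norm_ge_zero order_trans by blast
    show ?thesis
      unfolding n_state_def Pair prod.case norm_mult norm_power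
      by (intro mult_mono norm_n_weight_le[OF q] w norm_burge_sum_inf_chain_le[OF q pos(2) base]) auto
  qed
  have IH: "(n_state q \<beta> \<rho> K k has_sum
       (qfac_inf (q ^ ((K * \<beta> + \<rho> + \<beta>) * \<beta>)))\<^sup>2 / qfac_inf (q ^ (2 * ((K * \<beta> + \<rho> + \<beta>) * \<beta>))) / qfac_inf q) (n_index k \<times> UNIV)"
    "n_state (norm q) \<beta> \<rho> K k summable_on (n_index k \<times> UNIV)"
    using Suc by auto
  have p: "?p x \<in> n_index k \<times> UNIV" if "x \<in> n_index (Suc k) \<times> UNIV" for x
  proof -
    have "t \<in> {1..k}" if "((fst x)(Suc k := 0)) t \<noteq> 0" for t
    proof -
      have "t \<noteq> Suc k" "fst x t \<noteq> 0" using that by (auto split: if_splits)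
      moreover from this(2) have "t \<in> {1..Suc k}"
        using \<open>x \<in> n_index (Suc k) \<times> UNIV\<close> by (auto simp: n_index_def)
      ultimately show ?thesis by auto
    qed
    then show ?thesis by (simp add: n_index_def)
  qed
  show ?case
    using has_sum_fibres[OF IH p fib[OF _ q] fib[OF _ r] le] by blast
qed

section \<open>Comparison with the quadratic form of the continued fraction\<close>

lemma qpoch_eq_qfac: "qpoch q q n = qfac q n"
  by (simp add: qpoch_def qfac_def)

lemma qbinom_of_nat:
  assumes "norm q < 1"
  shows "qbinom q (int n) (int k) = gauss_binom q n k"
proof (cases "k \<le> n")
  case True
  then show ?thesis
    using gauss_binom_eq[OF assms True] by (simp add: qbinom_def qpoch_eq_qfac of_nat_diff[symmetric] del: of_nat_diff)
qed (simp add: qbinom_def)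

text \<open>Separating odd and even exponents gives (Q; Q^2)_\<infinity> (Q^2; Q^2)_\<infinity> =
  (Q; Q)_\<infinity> for Q = q^(ab), which brings the product into the form of the theta
  value.\<close>

lemma rhs_eq:
  assumes q: "norm q < 1" and "1 \<le> a" "1 \<le> b"
  shows "rhs q a b = (qfac_inf (q ^ (a * b)))\<^sup>2 / qfac_inf (q ^ (2 * (a * b))) / qfac_inf q"
proof -
  define Q where "Q = q ^ (a * b)"
  have Q: "norm Q < 1"
    using q assms(2,3) by (simp add: Q_def norm_power power_less_one_iff)
  have Q2: "norm (Q\<^sup>2) < 1"
    using Q by (simp add: norm_power power_less_one_iff)
  have "(\<Prod>i<n. 1 - Q * (Q\<^sup>2) ^ i) * qfac (Q\<^sup>2) n = qfac Q (2 * n)" for n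
  proof (induction n)
    case (Suc n)
    have "Q * (Q\<^sup>2) ^ n = Q ^ Suc (2 * n)" "(Q\<^sup>2) ^ Suc n = Q ^ Suc (Suc (2 * n))"
      by (simp_all add: power_mult power2_eq_square)
    then have "(\<Prod>i<Suc n. 1 - Q * (Q\<^sup>2) ^ i) * qfac (Q\<^sup>2) (Suc n) =
      ((\<Prod>i<n. 1 - Q * (Q\<^sup>2) ^ i) * qfac (Q\<^sup>2) n) * (1 - Q ^ Suc (2 * n)) * (1 - Q ^ Suc (Suc (2 * n)))"
      unfolding qfac_Suc by (simp only: prod.lessThan_Suc mult_ac)
    then show ?case
      unfolding Suc.IH by (simp only: qfac_Suc mult_Suc_right add_2_eq_Suc)
  qed simp
  moreover have "(\<lambda>n. (\<Prod>i<n. 1 - Q * (Q\<^sup>2) ^ i) * qfac (Q\<^sup>2) n) \<longlonglongrightarrow> qpoch_inf Q (Q\<^sup>2) * qfac_inf (Q\<^sup>2)"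
    unfolding qpoch_inf_def by (intro tendsto_mult prod_qpoch_tendsto[OF Q2] qfac_tendsto[OF Q2])
  moreover have "(\<lambda>n. qfac Q (2 * n)) \<longlonglongrightarrow> qfac_inf Q"
    using LIMSEQ_subseq_LIMSEQ[OF qfac_tendsto[OF Q], of "\<lambda>n. 2 * n"] by (simp add: strict_mono_def o_def)
  ultimately have "qpoch_inf Q (Q\<^sup>2) * qfac_inf (Q\<^sup>2) = qfac_inf Q"
    using LIMSEQ_unique by simp
  then have "qpoch_inf Q (Q\<^sup>2) = qfac_inf Q / qfac_inf (Q\<^sup>2)"
    using qfac_inf_nonzero[OF Q2] by (simp add: field_simps)
  moreover have "qpoch_inf x x = qfac_inf x" for x
    by (simp add: qpoch_inf_def qfac_inf_def)
  moreover have "q ^ (2 * (a * b)) = Q\<^sup>2"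
    by (simp add: Q_def power_mult[symmetric] mult_ac)
  moreover have "q ^ (2 * a * b) = Q\<^sup>2"
    by (simp add: Q_def power_mult[symmetric] mult_ac)
  ultimately show ?thesis
    using qfac_inf_nonzero[OF Q2] unfolding rhs_def Q_def[symmetric]
    by (simp add: power2_eq_square)
qed

section \<open>Rows of the matrix and the quadratic form\<close>

definition m_shift :: "nat \<Rightarrow> (nat \<Rightarrow> nat) \<Rightarrow> nat \<Rightarrow> nat" where
  "m_shift s m l = m (s + 1 + l)"

lemma dlt_conv:
  assumes "1 \<le> j"
  shows "dlt (int j) (int k) = (if k = j then 1 else 0)"
    "dlt (int j) (int k + 1) = (if k = j - 1 then 1 else 0)"
    "dlt (int j) (int k - 1) = (if k = Suc j then 1 else 0)"
  using assms by (auto simp: dlt_def)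

text \<open>Ordinary rows read -1, 2, -1 and exceptional rows -1, 1, 1. The left neighbour of the
  first row lies outside the summation range, and the right neighbour of the last row has value
  0.\<close>

lemma sum_Cmat:
  assumes ts: "cf_ok ts" and l: "l < sum_list ts"
    and m: "\<And>j. m j \<noteq> 0 \<Longrightarrow> j \<in> {s + 1..s + sum_list ts}"
  shows "(\<Sum>k\<in>{s + 1..s + sum_list ts}. Cmat (s # ts) (s + 1 + l) k * int (m k)) =
    (if hd ((cf_step ^^ l) ts) = 1
     then int (m_shift s m l) - (if l = 0 then 0 else int (m_shift s m (l - 1))) + int (m_shift s m (Suc l))
     else 2 * int (m_shift s m l) - (if l = 0 then 0 else int (m_shift s m (l - 1))) - int (m_shift s m (Suc l)))"
proof -
  let ?j = "s + 1 + l" and ?S = "{s + 1..s + sum_list ts}"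
  have T: "?j \<in> Tset (s # ts) \<longleftrightarrow> hd ((cf_step ^^ l) ts) = 1"
    using Suc_Tset_iff[OF ts l] by (auto simp: Tset_Cons image_iff)
  have j: "1 \<le> ?j" by simp
  have s1: "(\<Sum>k\<in>?S. (if k = ?j then 1 else 0) * int (m k)) = int (m_shift s m l)"
    using l by (simp add: m_shift_def if_distrib[of "\<lambda>x. x * _"] sum.delta cong: if_cong)
  have s2: "(\<Sum>k\<in>?S. (if k = ?j - 1 then 1 else 0) * int (m k)) = (if l = 0 then 0 else int (m_shift s m (l - 1)))"
    using l by (auto simp: m_shift_def if_distrib[of "\<lambda>x. x * _"] sum.delta cong: if_cong)
  have s3: "(\<Sum>k\<in>?S. (if k = Suc ?j then 1 else 0) * int (m k)) = int (m_shift s m (Suc l))"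
    using m[of "Suc ?j"] by (auto simp: m_shift_def if_distrib[of "\<lambda>x. x * _"] sum.delta cong: if_cong)
  define e where "e k = (if k = ?j then 1 else 0 :: int)" for k
  define e' where "e' k = (if k = ?j - 1 then 1 else 0 :: int)" for k
  define e'' where "e'' k = (if k = Suc ?j then 1 else 0 :: int)" for k
  have C: "Cmat (s # ts) ?j k = (if hd ((cf_step ^^ l) ts) = 1 then e k - e' k + e'' k else 2 * e k - e' k - e'' k)" for k
    unfolding Cmat_def Iscr_def T dlt_conv[OF j] e_def[symmetric] e'_def[symmetric] e''_def[symmetric] by simp
  show ?thesis
    unfolding C
    using s1[folded e_def] s2[folded e'_def] s3[folded e''_def]
    by (cases "hd ((cf_step ^^ l) ts) = 1")
       (simp_all add: left_diff_distrib distrib_right mult.assoc sum.distrib sum_subtractf sum_distrib_left[symmetric])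
qed

context
  fixes q :: complex and s :: nat and ts :: "nat list" and m :: "nat \<Rightarrow> nat"
  assumes q: "norm q < 1" and ts: "cf_ok ts" "ts \<noteq> [1]"
    and m: "\<And>j. m j \<noteq> 0 \<Longrightarrow> j \<in> {s + 1..s + sum_list ts}"
begin

private abbreviation "\<mu> \<equiv> m_shift s m"
private abbreviation "K \<equiv> sum_list ts"
private abbreviation "at_T l \<equiv> hd ((cf_step ^^ l) ts) = 1"
private abbreviation "rowsum l \<equiv> \<Sum>k\<in>{s + 1..s + K}. Cmat (s # ts) (s + 1 + l) k * int (m k)"

private lemma rowsum_eq: "l < K \<Longrightarrow> rowsum l = (if at_T l
     then int (\<mu> l) - (if l = 0 then 0 else int (\<mu> (l - 1))) + int (\<mu> (Suc l))
     else 2 * int (\<mu> l) - (if l = 0 then 0 else int (\<mu> (l - 1))) - int (\<mu> (Suc l)))"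
  using sum_Cmat[OF ts(1) _ m] by blast

private lemma K: "2 \<le> K"
  using cf_ok_sum_list(2)[OF ts] .

private lemma at_T_last: "at_T (K - 1)"
  using cf_step_funpow_last[OF ts(1)] by simp

private lemma \<mu>_K: "\<mu> K = 0"
  using m[of "s + 1 + K"] by (auto simp: m_shift_def)

text \<open>Downward induction from \<mu>_K = 0. In an ordinary row, 2 \<mu>_(l+1) \<le> \<mu>_l +
  \<mu>_(l+2) together with \<mu>_(l+2) \<le> \<mu>_(l+1) gives the claim; in an exceptional row
  \<mu>_(l+1) + \<mu>_(l+2) \<le> \<mu>_l suffices.\<close>

private lemma decreasing_if_rows_nonpos:
  assumes "\<And>l. 1 \<le> l \<Longrightarrow> l < K \<Longrightarrow> rowsum l \<le> 0" "l < K"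
  shows "\<mu> (Suc l) \<le> \<mu> l"
  using assms(2)
proof (induction "K - l" arbitrary: l rule: less_induct)
  case less
  show ?case
  proof (cases "Suc l = K")
    case True
    then show ?thesis using \<mu>_K by simp
  next
    case False
    then have l: "Suc l < K" using less.prems by simp
    then have "\<mu> (Suc (Suc l)) \<le> \<mu> (Suc l)" by (intro less.hyps) auto
    then show ?thesis
      using assms(1)[of "Suc l"] l rowsum_eq[OF l] by (auto split: if_splits)
  qed
qed

private lemma quadratic_form:
  assumes dec: "\<forall>l<K. \<mu> (Suc l) \<le> \<mu> l"
  shows "(\<Sum>j\<in>{s + 1..s + K}. \<Sum>k\<in>{s + 1..s + K}. int (m j) * Cmat (s # ts) j k * int (m k)) =
    int ((\<mu> 0)\<^sup>2 + (\<Sum>l<K - 1. (step_index ts \<mu> l)\<^sup>2))"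
proof -
  \<comment> \<open>each row contributes \<open>i\<^sub>l\<^sup>2\<close>, with \<open>i\<^sub>l\<close> the Burge index, plus \<open>H l - H (l + 1)\<close>\<close>
  define H where "H l = (int (\<mu> l))\<^sup>2 - int (\<mu> l) * (if l = 0 then 0 else int (\<mu> (l - 1)))" for l
  have tel: "(\<Sum>l<n. int (\<mu> l) * rowsum l) + H n = (int (\<mu> 0))\<^sup>2 + (\<Sum>l<n. (int (step_index ts \<mu> l))\<^sup>2)"
    if "n \<le> K" for n
    using that
  proof (induction n)
    case (Suc n)
    then have n: "n < K" by simp
    have "int (\<mu> n) * rowsum n + H (Suc n) = H n + (int (step_index ts \<mu> n))\<^sup>2"
      unfolding rowsum_eq[OF n] H_def step_index_def burge_index_def
      using dec n by (auto simp: of_nat_diff power2_eq_square algebra_simps)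
    then show ?case using Suc by simp
  qed (simp add: H_def)
  have "(\<Sum>j\<in>{s + 1..s + K}. \<Sum>k\<in>{s + 1..s + K}. int (m j) * Cmat (s # ts) j k * int (m k)) =
    (\<Sum>l<K. int (\<mu> l) * rowsum l)"
    by (rule sum.reindex_bij_witness[of _ "\<lambda>l. s + 1 + l" "\<lambda>j. j - (s + 1)"])
       (auto simp: m_shift_def sum_distrib_left mult.assoc)
  also have "\<dots> = (int (\<mu> 0))\<^sup>2 + (\<Sum>l<K. (int (step_index ts \<mu> l))\<^sup>2)"
    using tel[of K] \<mu>_K by (simp add: H_def)
  also have "(\<Sum>l<K. (int (step_index ts \<mu> l))\<^sup>2) = (\<Sum>l<K - 1. (int (step_index ts \<mu> l))\<^sup>2)"
  proof -
    \<comment> \<open>The last row is exceptional, so its index is the variable after it, which is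
      0.\<close>
    have "step_index ts \<mu> (K - 1) = 0"
      using at_T_last \<mu>_K K by (simp add: step_index_def burge_index_def)
    moreover have "K = Suc (K - 1)" using K by simp
    ultimately show ?thesis by (metis (no_types, lifting) add.right_neutral of_nat_0 sum.lessThan_Suc zero_power2)
  qed
  finally show ?thesis by simp
qed

private abbreviation "binfactor j \<equiv> qbinom (q ^ taubar (s # ts) j) (int (tau (s # ts) j * m j) + nB (s # ts) m j) (int (tau (s # ts) j * m j))"

private lemma nB_eq: "nB (s # ts) m (s + 1 + l) = - rowsum l"
  by (simp add: nB_def dimC_def)

private lemma product_factors: "(\<Prod>j\<in>{s + 2..s + K}. binfactor j) = (\<Prod>l=1..K - 1. binfactor (s + 1 + l))"
  by (rule prod.reindex_bij_witness[of _ "\<lambda>l. s + 1 + l" "\<lambda>j. j - (s + 1)"]) (use K in auto)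

text \<open>Outside the non-increasing sequences some n_j is negative, and \<open>qbinom\<close> is
  then 0; this matches the zero branch of \<open>m_weight\<close>.\<close>

private lemma factors_eq_0:
  assumes "l < K" "\<mu> l < \<mu> (Suc l)"
  shows "(\<Prod>l=1..K - 1. binfactor (s + 1 + l)) = 0"
proof -
  from decreasing_if_rows_nonpos[of l] assms obtain l' where l': "1 \<le> l'" "l' < K" "0 < rowsum l'"
    by (meson not_less)
  then have "binfactor (s + 1 + l') = 0"
    unfolding qbinom_def nB_eq by simp
  then show ?thesis using l' K by (auto intro!: bexI[of _ l'])
qed

private lemma factor_middle:
  assumes dec: "\<forall>l<K. \<mu> (Suc l) \<le> \<mu> l" and l: "1 \<le> l" "l < K - 1"
  shows "binfactor (s + 1 + l) = gauss_binom q (\<mu> (l - 1) + \<mu> l - step_index ts \<mu> l) (2 * \<mu> l)"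
proof -
  have lK: "l < K" using l by simp
  have tau: "tau (s # ts) (s + 1 + l) = 2" using l by (simp add: tau_def dimC_def)
  have le: "step_index ts \<mu> l \<le> \<mu> l"
    using dec lK by (auto simp: step_index_def burge_index_def)
  have "int (2 * m (s + 1 + l)) + nB (s # ts) m (s + 1 + l) = int (\<mu> (l - 1) + \<mu> l - step_index ts \<mu> l)"
    unfolding nB_eq rowsum_eq[OF lK] using l le dec lK
    by (auto simp: step_index_def burge_index_def of_nat_diff m_shift_def)
  then show ?thesis
    unfolding taubar_def tau
    using qbinom_of_nat[OF q, of "\<mu> (l - 1) + \<mu> l - step_index ts \<mu> l" "2 * m (s + 1 + l)"]
    by (simp add: m_shift_def)
qed

text \<open>The last factor is the end (1, 1) of the Euclidean algorithm, a Gaussian binomial in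
  base \<open>q\<^sup>2\<close> without doubled entries; this is why \<tau> changes from 2 to 1 at
  the last index.\<close>

private lemma factor_last:
  assumes dec: "\<forall>l<K. \<mu> (Suc l) \<le> \<mu> l"
  shows "binfactor (s + 1 + (K - 1)) = cf_burge_sum q [1] (\<mu> (K - 1)) (\<mu> (K - 2) - \<mu> (K - 1))"
proof -
  have q2: "norm (q\<^sup>2) < 1"
    using q by (simp add: norm_power power_less_one_iff)
  have lK: "K - 1 < K" using K by simp
  have tau: "tau (s # ts) (s + 1 + (K - 1)) = 1" using K by (simp add: tau_def dimC_def)
  have e: "K - 1 - 1 = K - 2" "Suc (K - 1) = K" "K - 1 \<noteq> 0" using K by auto
  have "int (m (s + 1 + (K - 1))) + nB (s # ts) m (s + 1 + (K - 1)) = int (\<mu> (K - 2))"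
    unfolding nB_eq rowsum_eq[OF lK] e using at_T_last e \<mu>_K by (simp add: m_shift_def)
  then have f: "binfactor (s + 1 + (K - 1)) = gauss_binom (q\<^sup>2) (\<mu> (K - 2)) (\<mu> (K - 1))"
    unfolding taubar_def tau
    using qbinom_of_nat[OF q2, of "\<mu> (K - 2)" "m (s + 1 + (K - 1))"] by (simp add: m_shift_def)
  have le: "\<mu> (K - 1) \<le> \<mu> (K - 2)"
    using dec[rule_format, of "K - 2"] K by (simp add: Suc_diff_Suc numeral_2_eq_2)
  show ?thesis
    unfolding f cf_burge_sum_singleton[OF q] using le gauss_binom_sym[OF q2 le] by simp
qed

lemma summandB_eq:
  assumes n: "n \<in> n_index s"
  shows "summandB q (s # ts) n m = n_weight q s n (\<mu> 0) * m_state q ts (K - 1) \<mu>"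
proof -
  have D: "dimC (s # ts) = s + K" by (simp add: dimC_def)
  have "(\<Prod>i\<in>{1..<s}. qpoch q q (n i)) * qpoch (q ^ taubar (s # ts) s) (q ^ taubar (s # ts) s) (n s)
      = (\<Prod>l=1..s. qfac q (n l))"
  proof (cases s)
    case 0
    \<comment> \<open>For \<open>s = 0\<close> the factor attached to index 0 must be empty.\<close>
    then have "n 0 = 0" using n by (auto simp: n_index_def)
    then show ?thesis using 0 by (simp add: qpoch_def)
  next
    case (Suc s')
    then have "{1..s} = insert s {1..<s}" by auto
    then show ?thesis
      using K by (simp add: qpoch_eq_qfac taubar_def tau_def dimC_def mult.commute)
  qed
  moreover have "qpoch (q ^ taubar (s # ts) (s + 1)) (q ^ taubar (s # ts) (s + 1)) (tau (s # ts) (s + 1) * m (s + 1)) = qfac q (2 * \<mu> 0)"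
    using K by (simp add: qpoch_eq_qfac taubar_def tau_def dimC_def m_shift_def)
  moreover have "(\<Sum>i\<in>{1..s}. (NB (s # ts) n i + int (m (s + 1)))\<^sup>2) = int (\<Sum>l=1..s. ((\<Sum>t=l..s. n t) + \<mu> 0)\<^sup>2)"
    by (simp add: NB_def m_shift_def)
  ultimately have B: "summandB q (s # ts) n m =
     q powi (int (\<Sum>l=1..s. ((\<Sum>t=l..s. n t) + \<mu> 0)\<^sup>2)
       + (\<Sum>j\<in>{s + 1..s + K}. \<Sum>k\<in>{s + 1..s + K}. int (m j) * Cmat (s # ts) j k * int (m k)))
     / ((\<Prod>l=1..s. qfac q (n l)) * qfac q (2 * \<mu> 0)) * (\<Prod>l=1..K - 1. binfactor (s + 1 + l))"
    unfolding summandB_def Let_def D product_factors[symmetric] nth_Cons_0 by (simp only:)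
  have last: "(cf_step ^^ (K - 1)) ts = [1]" by (rule cf_step_funpow_last[OF ts(1)])
  have K0: "K - 1 \<noteq> 0" using K by simp
  show ?thesis
  proof (cases "\<forall>l<K. \<mu> (Suc l) \<le> \<mu> l")
    case True
    note dec = True
    have "{1..K - 1} = insert (K - 1) {1..<K - 1}" using K by auto
    then have "(\<Prod>l=1..K - 1. binfactor (s + 1 + l)) = binfactor (s + 1 + (K - 1)) * (\<Prod>l=1..<K - 1. binfactor (s + 1 + l))"
      by simp
    also have "(\<Prod>l=1..<K - 1. binfactor (s + 1 + l)) = (\<Prod>l=1..<K - 1. gauss_binom q (\<mu> (l - 1) + \<mu> l - step_index ts \<mu> l) (2 * \<mu> l))"
      using factor_middle[OF dec] by (intro prod.cong) auto
    finally have P: "(\<Prod>l=1..K - 1. binfactor (s + 1 + l)) = cf_burge_sum q [1] (\<mu> (K - 1)) (\<mu> (K - 2) - \<mu> (K - 1))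
        * (\<Prod>l=1..<K - 1. gauss_binom q (\<mu> (l - 1) + \<mu> l - step_index ts \<mu> l) (2 * \<mu> l))"
      unfolding factor_last[OF dec] .
    have "(\<Prod>l<K - 1. if \<mu> (Suc l) \<le> \<mu> l then q ^ (step_index ts \<mu> l)\<^sup>2 else 0) = (\<Prod>l<K - 1. q ^ (step_index ts \<mu> l)\<^sup>2)"
      using dec by (intro prod.cong) auto
    also have "\<dots> = q ^ (\<Sum>l<K - 1. (step_index ts \<mu> l)\<^sup>2)"
      by (simp add: power_sum)
    finally have W: "m_weight q ts (K - 1) \<mu> = q ^ (\<mu> 0)\<^sup>2 / qfac q (2 * \<mu> 0) * q ^ (\<Sum>l<K - 1. (step_index ts \<mu> l)\<^sup>2)
        * (\<Prod>l=1..<K - 1. gauss_binom q (\<mu> (l - 1) + \<mu> l - step_index ts \<mu> l) (2 * \<mu> l))"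
      unfolding m_weight_def by simp
    have e: "K - 1 - 1 = K - 2" by simp
    have St: "m_state q ts (K - 1) \<mu> = m_weight q ts (K - 1) \<mu> * cf_burge_sum q [1] (\<mu> (K - 1)) (\<mu> (K - 2) - \<mu> (K - 1))"
      unfolding m_state_def last e using K0 by simp
    show ?thesis
      unfolding B P quadratic_form[OF dec] of_nat_add[symmetric] power_int_of_nat St W n_weight_def
      by (simp only: power_add times_divide_eq_left times_divide_eq_right divide_divide_eq_left mult_ac)
  next
    case False
    then obtain l where l: "l < K" "\<mu> l < \<mu> (Suc l)" by (auto simp: not_le)
    then have "Suc l \<noteq> K" using \<mu>_K by auto
    then have "m_weight q ts (K - 1) \<mu> = 0"
      using l by (intro m_weight_eq_0[of l]) auto
    then show ?thesis
      unfolding B factors_eq_0[OF l] using K0 by (simp add: m_state_def)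
  qed
qed

end

section \<open>Assembling the multiple sum\<close>

definition cf_value :: "complex \<Rightarrow> nat list \<Rightarrow> complex" where
  "cf_value q cs = (let \<alpha> = fst (cf_pair cs); \<beta> = snd (cf_pair cs) in
     (qfac_inf (q ^ ((\<alpha> + \<beta>) * \<beta>)))\<^sup>2 / qfac_inf (q ^ (2 * ((\<alpha> + \<beta>) * \<beta>))) / qfac_inf q)"

definition B_index :: "nat list \<Rightarrow> ((nat \<Rightarrow> nat) \<times> (nat \<Rightarrow> nat)) set" where
  "B_index cs = {(n, m). (\<forall>i. n i \<noteq> 0 \<longrightarrow> i \<in> {1..cs ! 0})
     \<and> (\<forall>j. m j \<noteq> 0 \<longrightarrow> j \<in> {cs ! 0 + 1..dimC cs})}"

lemma B_index_fibre:
  assumes n: "n \<in> n_index s" and K: "1 \<le> sum_list ts"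
  shows "{x \<in> B_index (s # ts). (fst x, snd x (s + 1)) = (n, i)} =
    (\<lambda>\<mu>. (n, \<lambda>j. if s < j then \<mu> (j - s - 1) else 0)) ` m_index i (sum_list ts - 1)" (is "?A = ?h ` _")
proof (intro equalityI subsetI)
  fix x assume x: "x \<in> ?A"
  then obtain m where m: "x = (n, m)" by (cases x) auto
  have sup: "j \<in> {s + 1..s + sum_list ts}" if "m j \<noteq> 0" for j
    using x that by (auto simp: m B_index_def dimC_def)
  have "m j = (if s < j then m_shift s m (j - s - 1) else 0)" for j
    using sup[of j] by (cases "s < j") (auto simp: m_shift_def)
  then have "x = ?h (m_shift s m)"
    by (simp add: m fun_eq_iff)
  moreover have "l \<le> sum_list ts - 1" if "m_shift s m l \<noteq> 0" for l
    using sup[of "s + 1 + l"] that by (simp add: m_shift_def)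
  then have "m_shift s m \<in> m_index i (sum_list ts - 1)"
    using x by (simp add: m m_shift_def m_index_def)
  ultimately show "x \<in> ?h ` m_index i (sum_list ts - 1)" by blast
next
  fix x assume "x \<in> ?h ` m_index i (sum_list ts - 1)"
  then obtain \<mu> where \<mu>: "x = ?h \<mu>" "\<mu> \<in> m_index i (sum_list ts - 1)" by blast
  have "j \<in> {s + 1..s + sum_list ts}" if "s < j" "\<mu> (j - s - 1) \<noteq> 0" for j
  proof -
    have "j - s - 1 \<le> sum_list ts - 1" using \<mu>(2) that by (auto simp: m_index_def)
    then show ?thesis using K that by auto
  qed
  then show "x \<in> ?A"
    using n \<mu>(2) by (auto simp: \<mu>(1) B_index_def dimC_def n_index_def m_index_def split: if_splits)
qed

text \<open>The pair of \<open>s # ts\<close> is (s \<beta> + \<rho>, \<beta>), so after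
  \<open>s\<close> chain steps \<rho> and \<beta> remain, which is the infinite sum attached to
  \<open>ts\<close>. Its index i is m_(s+1), and expanding over the fibre of i brings in the other
  m. The value \<open>s = 0\<close> is allowed.\<close>

lemma summandB_has_sum:
  assumes q: "norm q < 1" and ts: "cf_ok ts" "ts \<noteq> [1]"
  shows "((\<lambda>(n, m). summandB q (s # ts) n m) has_sum cf_value q (s # ts)) (B_index (s # ts))"
proof -
  define \<beta> \<rho> k where "\<beta> = fst (cf_pair ts)" and "\<rho> = snd (cf_pair ts)" and "k = sum_list ts - 1"
  have pos: "1 \<le> \<rho>" "1 \<le> \<beta>"
    using cf_pair_pos[of ts] ts(1) by (auto simp: \<beta>_def \<rho>_def cf_ok_def)
  have r: "norm (norm q) < 1" using q by simp
  have K: "2 \<le> sum_list ts" using cf_ok_sum_list(2)[OF ts] .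
  then have k: "k < sum_list ts" "1 \<le> sum_list ts" by (auto simp: k_def)
  have G: "burge_sum_inf x \<rho> \<beta> i = cf_burge_sum_inf x ts i" for x :: "'b::real_normed_field" and i
    by (simp add: cf_burge_sum_inf_def \<beta>_def \<rho>_def)
  have st: "n_state x \<beta> \<rho> s s = (\<lambda>(n, i). n_weight x s n i * (x ^ i\<^sup>2 * cf_burge_sum_inf x ts i))"
    for x :: "'b::real_normed_field"
    by (simp add: n_state_def G)
  have base: "norm (burge_sum_inf q \<rho> \<beta> i) \<le> burge_sum_inf (norm q) \<rho> \<beta> i" for i
    unfolding G by (rule norm_cf_burge_sum_inf_le[OF q ts])
  have S: "(qfac_inf (q ^ ((s * \<beta> + \<rho> + \<beta>) * \<beta>)))\<^sup>2 / qfac_inf (q ^ (2 * ((s * \<beta> + \<rho> + \<beta>) * \<beta>))) / qfac_inf q = cf_value q (s # ts)"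
    by (simp add: cf_value_def Let_def \<beta>_def \<rho>_def)
  note start = n_state_has_sum[OF q pos order_refl base, of s, unfolded S]
  define g where "g = (\<lambda>(n, m). n_weight q s n (m (s + 1)) * m_state q ts k (m_shift s m))"
  define gr where "gr = (\<lambda>(n, m). n_weight (norm q) s n (m (s + 1)) * m_state (norm q) ts k (m_shift s m))"
  let ?p = "\<lambda>x :: (nat \<Rightarrow> nat) \<times> (nat \<Rightarrow> nat). (fst x, snd x (s + 1))"
  let ?h = "\<lambda>n \<mu>. (n, \<lambda>j. if s < j then \<mu> (j - s - 1) else 0) :: (nat \<Rightarrow> nat) \<times> (nat \<Rightarrow> nat)"
  have inj: "inj_on (?h n) A" for n A
  proof (rule inj_onI)
    fix \<mu> \<nu> assume "?h n \<mu> = ?h n \<nu>"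
    then have "(if s < j then \<mu> (j - s - 1) else 0) = (if s < j then \<nu> (j - s - 1) else 0)" for j
      by (simp add: fun_eq_iff)
    from this[of "s + 1 + l" for l] show "\<mu> = \<nu>" by (simp add: fun_eq_iff)
  qed
  have shift: "m_shift s (\<lambda>j. if s < j then \<mu> (j - s - 1) else 0) = \<mu>" for \<mu>
    by (simp add: m_shift_def fun_eq_iff)
  have fib: "((\<lambda>(n, m). n_weight x s n (m (s + 1)) * m_state x ts k (m_shift s m)) has_sum n_state x \<beta> \<rho> s s z)
      {y \<in> B_index (s # ts). ?p y = z}"
    if "z \<in> n_index s \<times> UNIV" "norm x < 1" for z and x :: "'b::{real_normed_field,banach}"
  proof -
    obtain n i where z: "z = (n, i)" by (cases z)
    have n: "n \<in> n_index s" using that by (simp add: z)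
    have "((\<lambda>\<mu>. n_weight x s n i * m_state x ts k \<mu>) has_sum n_weight x s n i * (x ^ i\<^sup>2 * cf_burge_sum_inf x ts i)) (m_index i k)"
      using m_state_has_sum[OF that(2) ts k(1)] by (intro has_sum_cmult_right) auto
    also have "?this \<longleftrightarrow> ((\<lambda>\<mu>. n_weight x s n (\<mu> 0) * m_state x ts k \<mu>) has_sum
        n_weight x s n i * (x ^ i\<^sup>2 * cf_burge_sum_inf x ts i)) (m_index i k)"
      by (rule has_sum_cong) (simp add: m_index_def)
    finally show ?thesis
      unfolding z B_index_fibre[OF n k(2)] has_sum_reindex[OF inj] st k_def[symmetric]
      by (simp add: o_def shift)
  qed
  have p: "?p x \<in> n_index s \<times> UNIV" if "x \<in> B_index (s # ts)" for x
    using that by (auto simp: B_index_def n_index_def)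
  have le: "norm (g x) \<le> gr x" for x
    unfolding g_def gr_def case_prod_unfold norm_mult
    by (intro mult_mono norm_n_weight_le[OF q] norm_m_state_le[OF q ts k(1)]
        order_trans[OF norm_ge_zero norm_n_weight_le[OF q]]) auto
  have "(g has_sum cf_value q (s # ts)) (B_index (s # ts))"
  proof (rule has_sum_fibres(1)[OF conjunct1[OF start] conjunct2[OF start], where p = ?p and gr = gr])
    show "(g has_sum n_state q \<beta> \<rho> s s z) {y \<in> B_index (s # ts). ?p y = z}" if "z \<in> n_index s \<times> UNIV" for z
      unfolding g_def by (rule fib[OF that q])
    show "(gr has_sum n_state (norm q) \<beta> \<rho> s s z) {y \<in> B_index (s # ts). ?p y = z}" if "z \<in> n_index s \<times> UNIV" for z
      unfolding gr_def by (rule fib[OF that r])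
  qed (rule p le; assumption)+
  also have "?this \<longleftrightarrow> ?thesis"
  proof (rule has_sum_cong)
    fix x assume x: "x \<in> B_index (s # ts)"
    obtain n m where nm: "x = (n, m)" by (cases x)
    have "n \<in> n_index s" using x by (auto simp: nm B_index_def n_index_def)
    moreover have "m j \<noteq> 0 \<Longrightarrow> j \<in> {s + 1..s + sum_list ts}" for j
      using x by (auto simp: nm B_index_def dimC_def)
    ultimately have "summandB q (s # ts) n m = n_weight q s n (m_shift s m 0) * m_state q ts k (m_shift s m)"
      unfolding k_def by (intro summandB_eq[OF q ts])
    then show "g x = (case x of (n, m) \<Rightarrow> summandB q (s # ts) n m)"
      by (simp add: nm g_def m_shift_def)
  qed
  finally show ?thesis .
qed

text \<open>For b = 1 the chain ends at the pair (1, 1) after one step fewer than the quotient. The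
  unsplit index is n_(a_0) itself, and the value 1/(q^2; q^2)_i at (1, 1) explains the base of its
  factor.\<close>

lemma summandB_singleton_has_sum:
  assumes q: "norm q < 1"
  shows "((\<lambda>(n, m). summandB q [Suc s] n m) has_sum cf_value q [Suc s]) (B_index [Suc s])"
proof -
  have S: "(qfac_inf (q ^ ((s * 1 + 1 + 1) * 1)))\<^sup>2 / qfac_inf (q ^ (2 * ((s * 1 + 1 + 1) * 1))) / qfac_inf q = cf_value q [Suc s]"
    by (simp add: cf_value_def Let_def)
  let ?h = "\<lambda>(n, i). (n(Suc s := i), \<lambda>_. 0) :: (nat \<Rightarrow> nat) \<times> (nat \<Rightarrow> nat)"
  have img: "?h ` (n_index s \<times> UNIV) = B_index [Suc s]"
  proof (intro equalityI subsetI)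
    fix x assume "x \<in> B_index [Suc s]"
    then obtain n where x: "x = (n, \<lambda>_. 0)" "\<And>t. n t \<noteq> 0 \<Longrightarrow> t \<in> {1..Suc s}"
      by (cases x) (auto simp: B_index_def dimC_def fun_eq_iff)
    have "t \<in> {1..s}" if "(n(Suc s := 0)) t \<noteq> 0" for t
      using x(2)[of t] that by (auto split: if_splits)
    then have "n(Suc s := 0) \<in> n_index s" by (simp add: n_index_def)
    moreover have "x = ?h (n(Suc s := 0), n (Suc s))" by (simp add: x(1))
    ultimately show "x \<in> ?h ` (n_index s \<times> UNIV)" by blast
  next
    fix x assume "x \<in> ?h ` (n_index s \<times> UNIV)"
    then obtain n i where "x = ?h (n, i)" "n \<in> n_index s" by blast
    then show "x \<in> B_index [Suc s]"
      by (auto simp: B_index_def n_index_def le_Suc_eq dimC_def split: if_splits)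
  qed
  have inj: "inj_on ?h (n_index s \<times> UNIV)"
  proof (rule inj_onI)
    fix x y assume xy: "x \<in> n_index s \<times> (UNIV :: nat set)" "y \<in> n_index s \<times> (UNIV :: nat set)" "?h x = ?h y"
    obtain n i n' i' where e: "x = (n, i)" "y = (n', i')" by (cases x, cases y)
    have u: "n(Suc s := i) = n'(Suc s := i')" using xy by (simp add: e)
    then have "i = i'" by (metis fun_upd_same)
    moreover have "n t = n' t" for t
    proof (cases "t = Suc s")
      case True
      have "n (Suc s) = 0" "n' (Suc s) = 0" using xy by (auto simp: e n_index_def)
      then show ?thesis using True by simp
    next
      case False
      then show ?thesis using u by (metis fun_upd_other)
    qed
    ultimately show "x = y" by (auto simp: e)
  qed
  have "(n_state q 1 1 s s has_sum cf_value q [Suc s]) (n_index s \<times> UNIV)"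
    using n_state_has_sum[OF q order_refl order_refl order_refl norm_burge_sum_inf_1_1_le[OF q], of s, unfolded S] by blast
  also have "?this \<longleftrightarrow> (((\<lambda>(n, m). summandB q [Suc s] n m) \<circ> ?h) has_sum cf_value q [Suc s]) (n_index s \<times> UNIV)"
  proof (rule has_sum_cong)
    fix x :: "(nat \<Rightarrow> nat) \<times> nat" assume "x \<in> n_index s \<times> UNIV"
    obtain n i where x: "x = (n, i)" by (cases x)
    let ?n = "n(Suc s := i)"
    have NB: "NB [Suc s] ?n l = int ((\<Sum>t=l..s. n t) + i)" if "l \<le> Suc s" for l
    proof -
      have "(\<Sum>t=l..Suc s. ?n t) = (\<Sum>t=l..s. ?n t) + i" using that by simp
      also have "(\<Sum>t=l..s. ?n t) = (\<Sum>t=l..s. n t)" by (rule sum.cong) auto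
      finally show ?thesis by (simp add: NB_def of_nat_sum[symmetric] del: of_nat_sum)
    qed
    have "(\<Sum>l\<in>{1..Suc s}. (NB [Suc s] ?n l + int 0)\<^sup>2) = (\<Sum>l\<in>{1..Suc s}. int (((\<Sum>t=l..s. n t) + i)\<^sup>2))"
      by (rule sum.cong) (auto simp: NB)
    also have "\<dots> = int ((\<Sum>l=1..s. ((\<Sum>t=l..s. n t) + i)\<^sup>2) + i\<^sup>2)"
      by simp
    finally have E: "(\<Sum>l\<in>{1..Suc s}. (NB [Suc s] ?n l + int 0)\<^sup>2) = \<dots>" .
    have P: "(\<Prod>l\<in>{1..<Suc s}. qpoch q q (?n l)) = (\<Prod>l=1..s. qfac q (n l))"
      by (rule prod.cong) (auto simp: qpoch_eq_qfac)
    have e: "{Suc s + 1..Suc s} = {}" "{Suc s + 2..Suc s} = {}" by auto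
    have d: "dimC [Suc s] = Suc s" by (simp add: dimC_def)
    have t: "taubar [Suc s] (Suc s) = 2" by (simp add: taubar_def tau_def d)
    have "summandB q [Suc s] ?n (\<lambda>_. 0) =
        q ^ ((\<Sum>l=1..s. ((\<Sum>t=l..s. n t) + i)\<^sup>2) + i\<^sup>2) / ((\<Prod>l=1..s. qfac q (n l)) * qfac (q\<^sup>2) i)"
      unfolding summandB_def Let_def nth_Cons_0 E P d t e sum.empty prod.empty add_0_right power_int_of_nat
      by (simp add: qpoch_eq_qfac qpoch_def[of _ _ 0])
    then show "n_state q 1 1 s s x = ((\<lambda>(n, m). summandB q [Suc s] n m) \<circ> ?h) x"
      using burge_sum_inf_1_1[OF q, of i] by (simp add: x n_state_def n_weight_def power_add)
  qed
  finally show ?thesis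
    unfolding has_sum_reindex[OF inj, symmetric] img .
qed

text \<open>The case \<open>a < 2b\<close> is the case \<open>a \<ge> 2b\<close> for \<open>a\<^sub>0 = 0\<close>, with \<open>a/b - 1 = [0, a\<^sub>0, \<dots>, a\<^sub>n]\<close>.\<close>

lemma summandA_eq:
  assumes "2 \<le> dimC cs"
  shows "summandA q cs m = summandB q (0 # cs) (\<lambda>_. 0) m"
proof -
  have C: "Cmat (0 # cs) j k = Cmat cs j k" if "1 \<le> j" for j k
    using that by (simp add: Cmat_def Iscr_def Tset_Cons)
  have d: "dimC (0 # cs) = dimC cs" by (simp add: dimC_def)
  have t: "tau (0 # cs) = tau cs" "taubar (0 # cs) = taubar cs"
    by (auto simp: tau_def taubar_def d fun_eq_iff)
  have n: "nB (0 # cs) m j = nA cs m j" if "1 \<le> j" for j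
    using that by (simp add: nA_def nB_def d C)
  have "(\<Sum>j\<in>{1..dimC cs}. \<Sum>k\<in>{1..dimC cs}. int (m j) * Cmat (0 # cs) j k * int (m k)) =
      (\<Sum>j\<in>{1..dimC cs}. \<Sum>k\<in>{1..dimC cs}. int (m j) * Cmat cs j k * int (m k))"
    by (intro sum.cong refl) (simp add: C)
  moreover have "(\<Prod>j\<in>{2..dimC cs}. qbinom (q ^ taubar cs j) (int (tau cs j * m j) + nB (0 # cs) m j) (int (tau cs j * m j))) =
      (\<Prod>j\<in>{2..dimC cs}. qbinom (q ^ taubar cs j) (int (tau cs j * m j) + nA cs m j) (int (tau cs j * m j)))"
    by (intro prod.cong refl) (simp add: n)
  moreover have "tau cs 1 = 2" "taubar cs 1 = 1"
    using assms by (auto simp: tau_def taubar_def)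
  ultimately show ?thesis
    unfolding summandA_def summandB_def Let_def nth_Cons_0 d t
    by (simp add: qpoch_def[of _ _ 0] numeral_2_eq_2)
qed

theorem theorem7p2:
  fixes q :: complex and a b :: nat and cs :: "nat list"
  assumes "norm q < 1" and "1 \<le> b" and "b < a" and "coprime a b"
    and "is_cf_expansion a b cs"
  shows "(a < 2 * b \<longrightarrow>
           (summandA q cs has_sum rhs q a b)
             {m. \<forall>j. m j \<noteq> 0 \<longrightarrow> j \<in> {1..dimC cs}})
       \<and> (2 * b \<le> a \<longrightarrow>
           ((\<lambda>(n, m). summandB q cs n m) has_sum rhs q a b)
             {(n, m). (\<forall>i. n i \<noteq> 0 \<longrightarrow> i \<in> {1..cs ! 0})
                    \<and> (\<forall>j. m j \<noteq> 0 \<longrightarrow> j \<in> {cs ! 0 + 1..dimC cs})})"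
proof (intro conjI impI)
  note q = assms(1)
  have cs: "cs \<noteq> []" "\<forall>c\<in>set cs. 1 \<le> c" "cfval cs = cf_target a b"
    and last: "if (a, b) = (2, 1) then cs = [1] else 2 \<le> last cs"
    using assms(5) by (auto simp: is_cf_expansion_def)
  have val: "cfval cs = of_nat (fst (cf_pair cs)) / of_nat (snd (cf_pair cs))"
    by (rule cfval_eq_cf_pair[OF cs(1,2)])
  have pos: "1 \<le> fst (cf_pair cs)" "1 \<le> snd (cf_pair cs)"
    using cf_pair_pos[OF cs(2)] cs(1) by auto
  have cop: "coprime (a - b) b"
    using assms(3,4) by (metis coprime_diff_one_left_nat coprime_iff_gcd_eq_1 gcd_diff1_nat less_imp_le)
  have diff: "(of_nat a / of_nat b - 1 :: rat) = of_nat (a - b) / of_nat b"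
    using assms(2,3) by (simp add: field_simps of_nat_diff)
  \<comment> \<open>Fractions in lowest terms are unique, so the value of the expansion determines
    the pair.\<close>
  have lowest: "fst (cf_pair cs) = x \<and> snd (cf_pair cs) = y"
    if "cfval cs = of_nat x / of_nat y" "coprime x y" "1 \<le> y" for x y
  proof -
    have "(of_nat (fst (cf_pair cs)) / of_nat (snd (cf_pair cs)) :: rat) = of_nat x / of_nat y"
      using val that(1) by simp
    then have "(of_nat (fst (cf_pair cs) * y) :: rat) = of_nat (x * snd (cf_pair cs))"
      using pos that(3) by (simp add: field_simps)
    then have e: "fst (cf_pair cs) * y = x * snd (cf_pair cs)"
      by (simp only: of_nat_eq_iff)
    then show ?thesis
      using coprime_crossproduct_nat[OF coprime_cf_pair[of cs] that(2)] by (simp add: mult.commute)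
  qed
  have R: "rhs q a b = (qfac_inf (q ^ (a * b)))\<^sup>2 / qfac_inf (q ^ (2 * (a * b))) / qfac_inf q"
    using assms by (intro rhs_eq) auto
  show "(summandA q cs has_sum rhs q a b) {m. \<forall>j. m j \<noteq> 0 \<longrightarrow> j \<in> {1..dimC cs}}" if ab: "a < 2 * b"
  proof -
    have "cfval cs = of_nat b / of_nat (a - b)"
      using ab by (simp add: cs(3) cf_target_def cf_sign_def diff power_int_minus del: of_nat_diff)
    then have pr: "fst (cf_pair cs) = b \<and> snd (cf_pair cs) = a - b"
      using cop assms(3) by (intro lowest) (auto simp: coprime_commute)
    have "2 \<le> last cs" using last ab by (auto split: if_splits)
    then have ok: "cf_ok cs" "cs \<noteq> [1]" using cs by (auto simp: cf_ok_def)
    \<comment> \<open>The prefixed 0 inverts the fraction to (a - b)/b, whence \<alpha> + \<beta> =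
      a and \<beta> = b.\<close>
    have v: "cf_value q (0 # cs) = rhs q a b"
      using pr assms(3) by (simp add: R cf_value_def Let_def)
    have B: "B_index (0 # cs) = Pair (\<lambda>_. 0) ` {m. \<forall>j. m j \<noteq> 0 \<longrightarrow> j \<in> {1..dimC cs}}"
      by (auto simp: B_index_def dimC_def fun_eq_iff image_iff)
    have "(((\<lambda>(n, m). summandB q (0 # cs) n m) \<circ> Pair (\<lambda>_. 0)) has_sum rhs q a b) {m. \<forall>j. m j \<noteq> 0 \<longrightarrow> j \<in> {1..dimC cs}}"
      using summandB_has_sum[OF q ok, of 0] unfolding v B
      by (subst (asm) has_sum_reindex) (auto simp: inj_on_def)
    then show ?thesis
      using cf_ok_sum_list(2)[OF ok] by (simp add: o_def summandA_eq[symmetric] dimC_def)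
  qed
  show "((\<lambda>(n, m). summandB q cs n m) has_sum rhs q a b)
     {(n, m). (\<forall>i. n i \<noteq> 0 \<longrightarrow> i \<in> {1..cs ! 0}) \<and> (\<forall>j. m j \<noteq> 0 \<longrightarrow> j \<in> {cs ! 0 + 1..dimC cs})}" if ab: "2 * b \<le> a"
    unfolding B_index_def[symmetric]
  proof -
    have "cfval cs = of_nat (a - b) / of_nat b"
    proof (cases "a = 2 * b")
      case True
      \<comment> \<open>The exponent \<open>cf_sign\<close> is 0 here, but the target 1 is still (a
        - b)/b.\<close>
      then show ?thesis using assms(2) by (simp add: cs(3) cf_target_def cf_sign_def)
    next
      case False
      then show ?thesis using ab by (simp add: cs(3) cf_target_def cf_sign_def diff del: of_nat_diff)
    qed
    then have pr: "fst (cf_pair cs) = a - b \<and> snd (cf_pair cs) = b"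
      using cop assms(2) by (intro lowest) auto
    then have v: "cf_value q cs = rhs q a b"
      using assms(3) by (simp add: R cf_value_def Let_def)
    obtain s ts where c: "cs = s # ts" using cs(1) by (cases cs) auto
    show "((\<lambda>(n, m). summandB q cs n m) has_sum rhs q a b) (B_index cs)"
    proof (cases "ts = []")
      case True
      then obtain s' where "cs = [Suc s']" using c cs(2) by (cases s) auto
      then show ?thesis using summandB_singleton_has_sum[OF q, of s'] v by simp
    next
      case False
      \<comment> \<open>A nonempty tail excludes \<open>cs = [1]\<close>, so the last quotient is at
        least 2 and belongs to \<open>ts\<close>.\<close>
      then have "2 \<le> last ts" using last c by (auto split: if_splits)
      then have "cf_ok ts" "ts \<noteq> [1]" using cs(2) c False by (auto simp: cf_ok_def)
      then show ?thesis using summandB_has_sum[OF q, of ts s] v c by simp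
    qed
  qed
qed

end
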